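(* Let $E\subset\mathbb{R}$ be minimal for conformal dimension, and suppose $E$ supports a Borel measure $\lambda$ such that for every $\varepsilon>0$ there is a constant $C=C(\varepsilon)\in(0,\infty)$ with $$\frac1C\, r^{1+\varepsilon}\le \lambda(E\cap B(x,r))\le C\, r^{1-\varepsilon}\qquad\text{for all } x\in E \text{ and all } 0<r\le 1.$$ Then $E\times Y$ is minimal for conformal dimension for every nonempty compact metric space $Y$.
   Context: $B(x,r)$ is the open ball with center $x$ and radius $r$. $E\subset\mathbb R$ carries the Euclidean metric, and $E\times Y$ carries a product metric, e.g. $d((x,y),(x',y'))=\max\{|x-x'|,d_Y(y,y')\}$. Given a homeomorphism $\eta:[0,\infty)\to[0,\infty)$, an embedding $f$ (a homeomorphism onto its image) from a metric space $(X,d_X)$ into a metric space $(Z,d_Z)$ is $\eta$-quasisymmetric if for all distinct triples $x,y,z\in X$ and all $t>0$, $\frac{d_X(x,y)}{d_X(y,z)}\le t$ implies $\frac{d_Z(f(x),f(y))}{d_Z(f(y),f(z))}\le \eta(t)$. It is quasisymmetric if it is $\eta$-quasisymmetric for some $\eta$. The conformal dimension of $X$ is the infimum of $\dim_H f(X)$ (Hausdorff dimension) over all quasisymmetric maps $f$ defined on $X$ with values in arbitrary metric spaces. $X$ is minimal for conformal dimension if its conformal dimension equals $\dim_H X$. *)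

theory Defs
  imports "HOL-Analysis.Analysis"
begin

definition ext_diameter :: "('a \<Rightarrow> 'a \<Rightarrow> real) \<Rightarrow> 'a set \<Rightarrow> ennreal" where
  "ext_diameter d U = (SUP x\<in>U. SUP y\<in>U. ennreal (d x y))"

text \<open>The \<open>s\<close>-th power of the diameter, used only for sets of finite diameter. Since
  \<open>0 powr 0 = 0\<close>, the case \<open>s = 0\<close> is treated separately, so that nonempty sets get the value 1
  there (and the zero-dimensional Hausdorff measure is counting measure).\<close>

definition diameter_pow :: "('a \<Rightarrow> 'a \<Rightarrow> real) \<Rightarrow> real \<Rightarrow> 'a set \<Rightarrow> ennreal" where
  "diameter_pow d s U =
     (if U = {} then 0 else if s = 0 then 1 else ennreal (enn2real (ext_diameter d U) powr s))"

text \<open>The infimum is over countable covers by sets of diameter at most \<open>\<delta>\<close>; it is infinite if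
  there are none. Finite covers are included because members may be empty.\<close>

definition hausdorff_content :: "'a set \<Rightarrow> ('a \<Rightarrow> 'a \<Rightarrow> real) \<Rightarrow> real \<Rightarrow> real \<Rightarrow> ennreal" where
  "hausdorff_content X d s \<delta> =
     (INF U \<in> {U :: nat \<Rightarrow> 'a set.
                (\<forall>i. U i \<subseteq> X \<and> ext_diameter d (U i) \<le> ennreal \<delta>) \<and> X \<subseteq> (\<Union>i. U i)}.
        \<Sum>i. diameter_pow d s (U i))"

definition hausdorff_measure :: "'a set \<Rightarrow> ('a \<Rightarrow> 'a \<Rightarrow> real) \<Rightarrow> real \<Rightarrow> ennreal" where
  "hausdorff_measure X d s = (SUP \<delta>\<in>{0<..}. hausdorff_content X d s \<delta>)"

definition hausdorff_dim :: "'a set \<Rightarrow> ('a \<Rightarrow> 'a \<Rightarrow> real) \<Rightarrow> ennreal" where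
  "hausdorff_dim X d = Inf {ennreal s | s. 0 \<le> s \<and> hausdorff_measure X d s = 0}"

definition eta_quasisymmetric ::
    "(real \<Rightarrow> real) \<Rightarrow> 'a set \<Rightarrow> ('a \<Rightarrow> 'a \<Rightarrow> real) \<Rightarrow> 'b set \<Rightarrow> ('b \<Rightarrow> 'b \<Rightarrow> real) \<Rightarrow> ('a \<Rightarrow> 'b) \<Rightarrow> bool"
  where
  "eta_quasisymmetric \<eta> X dX Z dZ f \<longleftrightarrow>
     embedding_map (Metric_space.mtopology X dX) (Metric_space.mtopology Z dZ) f \<and>
     (\<forall>x\<in>X. \<forall>y\<in>X. \<forall>z\<in>X. x \<noteq> y \<longrightarrow> y \<noteq> z \<longrightarrow> x \<noteq> z \<longrightarrow>
        (\<forall>t>0. dX x y / dX y z \<le> t \<longrightarrow> dZ (f x) (f y) / dZ (f y) (f z) \<le> \<eta> t))"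

definition quasisymmetric ::
    "'a set \<Rightarrow> ('a \<Rightarrow> 'a \<Rightarrow> real) \<Rightarrow> 'b set \<Rightarrow> ('b \<Rightarrow> 'b \<Rightarrow> real) \<Rightarrow> ('a \<Rightarrow> 'b) \<Rightarrow> bool" where
  "quasisymmetric X dX Z dZ f \<longleftrightarrow>
     (\<exists>\<eta>. homeomorphic_map (top_of_set {0..}) (top_of_set {0..}) \<eta> \<and>
          eta_quasisymmetric \<eta> X dX Z dZ f)"

text \<open>The target spaces are all metric spaces with points in the type of the source. This loses
  nothing: quasisymmetric maps are injective, so every image is isometric to such a space.
  Lemma \<open>conformal_dim_le\<close> below confirms that the value bounds the dimension of
  quasisymmetric images in metric spaces over any type.\<close>

definition conformal_dim :: "'a set \<Rightarrow> ('a \<Rightarrow> 'a \<Rightarrow> real) \<Rightarrow> ennreal" where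
  "conformal_dim X d =
     Inf {hausdorff_dim (f ` X) dZ | (f :: 'a \<Rightarrow> 'a) (Z :: 'a set) dZ.
            Metric_space Z dZ \<and> quasisymmetric X d Z dZ f}"

definition minimal_for_conformal_dim :: "'a set \<Rightarrow> ('a \<Rightarrow> 'a \<Rightarrow> real) \<Rightarrow> bool" where
  "minimal_for_conformal_dim X d \<longleftrightarrow> conformal_dim X d = hausdorff_dim X d"

definition max_dist ::
    "('a \<Rightarrow> 'a \<Rightarrow> real) \<Rightarrow> ('b \<Rightarrow> 'b \<Rightarrow> real) \<Rightarrow> 'a \<times> 'b \<Rightarrow> 'a \<times> 'b \<Rightarrow> real" where
  "max_dist dX dY = (\<lambda>(x, y) (x', y'). max (dX x x') (dY y y'))"

lemma Metric_space_max_dist: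
  assumes "Metric_space X dX" "Metric_space Y dY"
  shows "Metric_space (X \<times> Y) (max_dist dX dY)"
proof -
  interpret X: Metric_space X dX by fact
  interpret Y: Metric_space Y dY by fact
  show ?thesis
  proof
    fix p q assume "p \<in> X \<times> Y" "q \<in> X \<times> Y"
    then obtain x y x' y' where p: "p = (x, y)" "x \<in> X" "y \<in> Y"
      and q: "q = (x', y')" "x' \<in> X" "y' \<in> Y"
      by blast
    have "max (dX x x') (dY y y') = 0 \<longleftrightarrow> dX x x' = 0 \<and> dY y y' = 0"
      using X.nonneg[of x x'] Y.nonneg[of y y'] by linarith
    then show "max_dist dX dY p q = 0 \<longleftrightarrow> p = q"
      using p q by (simp add: max_dist_def)
  next
    show "max_dist dX dY p r \<le> max_dist dX dY p q + max_dist dX dY q r"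
      if "p \<in> X \<times> Y" "q \<in> X \<times> Y" "r \<in> X \<times> Y" for p q r
      using that X.triangle[of "fst p" "fst q" "fst r"] Y.triangle[of "snd p" "snd q" "snd r"]
      by (auto simp: max_dist_def)
  qed (auto simp: max_dist_def X.commute Y.commute le_max_iff_disj)
qed

lemma ext_diameter_image:
  "ext_diameter d (f ` U) = ext_diameter (\<lambda>x y. d (f x) (f y)) U"
  by (simp add: ext_diameter_def image_image)

lemma diameter_pow_image:
  "diameter_pow d s (f ` U) = diameter_pow (\<lambda>x y. d (f x) (f y)) s U"
  by (simp add: diameter_pow_def ext_diameter_image)

lemma hausdorff_content_isometry:
  "hausdorff_content (f ` X) d s \<delta> = hausdorff_content X (\<lambda>x y. d (f x) (f y)) s \<delta>"
proof (rule antisym)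
  show "hausdorff_content (f ` X) d s \<delta> \<le> hausdorff_content X (\<lambda>x y. d (f x) (f y)) s \<delta>"
    unfolding hausdorff_content_def
  proof (rule INF_mono)
    fix U :: "nat \<Rightarrow> 'b set"
    assume U: "U \<in> {U. (\<forall>i. U i \<subseteq> X \<and> ext_diameter (\<lambda>x y. d (f x) (f y)) (U i) \<le> ennreal \<delta>)
      \<and> X \<subseteq> (\<Union>i. U i)}"
    show "\<exists>V\<in>{V. (\<forall>i. V i \<subseteq> f ` X \<and> ext_diameter d (V i) \<le> ennreal \<delta>) \<and> f ` X \<subseteq> (\<Union>i. V i)}.
      (\<Sum>i. diameter_pow d s (V i)) \<le> (\<Sum>i. diameter_pow (\<lambda>x y. d (f x) (f y)) s (U i))"
      using U by (intro bexI[of _ "\<lambda>i. f ` U i"])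
        (fastforce simp: ext_diameter_image diameter_pow_image)+
  qed
next
  show "hausdorff_content X (\<lambda>x y. d (f x) (f y)) s \<delta> \<le> hausdorff_content (f ` X) d s \<delta>"
    unfolding hausdorff_content_def
  proof (rule INF_mono)
    fix V :: "nat \<Rightarrow> 'a set"
    assume V: "V \<in> {V. (\<forall>i. V i \<subseteq> f ` X \<and> ext_diameter d (V i) \<le> ennreal \<delta>)
      \<and> f ` X \<subseteq> (\<Union>i. V i)}"
    define U where "U i = {x \<in> X. f x \<in> V i}" for i
    have img: "f ` U i = V i" for i
      using V by (force simp: U_def)
    have "ext_diameter (\<lambda>x y. d (f x) (f y)) (U i) = ext_diameter d (V i)"
      "diameter_pow (\<lambda>x y. d (f x) (f y)) s (U i) = diameter_pow d s (V i)" for i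
      by (simp_all flip: img add: ext_diameter_image diameter_pow_image)
    moreover have "U i \<subseteq> X" for i by (auto simp: U_def)
    moreover have "X \<subseteq> (\<Union>i. U i)" using V by (fastforce simp: U_def)
    ultimately show "\<exists>U\<in>{U. (\<forall>i. U i \<subseteq> X \<and> ext_diameter (\<lambda>x y. d (f x) (f y)) (U i) \<le> ennreal \<delta>)
      \<and> X \<subseteq> (\<Union>i. U i)}.
      (\<Sum>i. diameter_pow (\<lambda>x y. d (f x) (f y)) s (U i)) \<le> (\<Sum>i. diameter_pow d s (V i))"
      using V by (intro bexI[of _ U]) auto
  qed
qed

lemma hausdorff_dim_isometry:
  "hausdorff_dim (f ` X) d = hausdorff_dim X (\<lambda>x y. d (f x) (f y))"
  by (simp add: hausdorff_dim_def hausdorff_measure_def hausdorff_content_isometry)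

lemma conformal_dim_le:
  fixes X :: "'a set" and Z :: "'b set"
  assumes X: "Metric_space X dX" and Z: "Metric_space Z dZ"
    and f: "quasisymmetric X dX Z dZ f"
  shows "conformal_dim X dX \<le> hausdorff_dim (f ` X) dZ"
proof -
  interpret X: Metric_space X dX by fact
  interpret Z: Metric_space Z dZ by fact
  define e where "e = (\<lambda>x y. dZ (f x) (f y))"
  obtain \<eta> where \<eta>: "homeomorphic_map (top_of_set {0..}) (top_of_set {0..}) \<eta>"
    and q: "eta_quasisymmetric \<eta> X dX Z dZ f"
    using f by (auto simp: quasisymmetric_def)
  have emb: "embedding_map X.mtopology Z.mtopology f"
    using q by (simp add: eta_quasisymmetric_def)
  have inj: "inj_on f X"
    using homeomorphic_imp_injective_map[OF emb[unfolded embedding_map_def]]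
    by (simp only: X.topspace_mtopology)
  have "f ` X = Z \<inter> f ` X"
    using homeomorphic_imp_surjective_map[OF emb[unfolded embedding_map_def]]
    by (simp only: topspace_subtopology X.topspace_mtopology Z.topspace_mtopology)
  then have sub: "f ` X \<subseteq> Z"
    by blast
  interpret e: Metric_space X e
  proof
    show "e x y = 0 \<longleftrightarrow> x = y" if "x \<in> X" "y \<in> X" for x y
      using that inj sub by (auto simp: e_def inj_on_def image_subset_iff)
    show "e x z \<le> e x y + e y z" if "x \<in> X" "y \<in> X" "z \<in> X" for x y z
      using that sub by (auto simp: e_def image_subset_iff intro!: Z.triangle)
  qed (auto simp: e_def Z.commute)
  interpret S: Submetric Z dZ "f ` X"
    using sub by unfold_locales
  define g where "g = the_inv_into X f"
  have g: "g (f x) = x" if "x \<in> X" for x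
    using that inj by (simp add: g_def the_inv_into_f_f)
  interpret ge: Metric_space12 "f ` X" dZ X e
    by unfold_locales
  have "homeomorphic_map S.sub.mtopology e.mtopology g"
    by (rule ge.isometry_imp_homeomorphic_map) (force simp: g e_def image_image)+
  moreover have "homeomorphic_map X.mtopology S.sub.mtopology f"
    using emb by (simp add: embedding_map_def S.mtopology_submetric)
  ultimately have "homeomorphic_map X.mtopology e.mtopology (g \<circ> f)"
    using homeomorphic_map_compose by blast
  then have "homeomorphic_map X.mtopology e.mtopology id"
    by (rule homeomorphic_map_eq) (simp add: g)
  then have "embedding_map X.mtopology e.mtopology id"
    by (simp flip: surjective_embedding_map)
  then have "quasisymmetric X dX X e id"
    using \<eta> q unfolding quasisymmetric_def eta_quasisymmetric_def e_def by auto
  then have "conformal_dim X dX \<le> hausdorff_dim (id ` X) e"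
    unfolding conformal_dim_def using e.Metric_space_axioms by (intro Inf_lower) blast
  then show ?thesis
    by (simp add: hausdorff_dim_isometry e_def)
qed

end

theory Submission
  imports Defs
begin

text \<open>
  Suppose \<open>E\<close> is nonempty. The growth of the measure forces \<open>dim E \<ge> 1\<close>, so minimality says that
  every quasisymmetric image of \<open>E\<close> has dimension at least 1, and \<open>dim (E \<times> Y) \<le> 1 + dim Y\<close> because
  \<open>E\<close> lies in the line. What has to be shown is that \<open>dim f(E \<times> Y) \<ge> 1 + dim Y\<close> for every
  quasisymmetric \<open>f\<close> (\<open>hausdorff_dim_quasisymmetric_image_times_ge\<close>). It suffices that
  \<open>H\<^sup>p(f(E \<times> Y)) = 0\<close> and \<open>s > p - 1\<close> imply \<open>H\<^sup>s(Y) = 0\<close> (\<open>hausdorff_null_factor\<close>).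

  Cover \<open>f(E \<times> Y)\<close> by sets \<open>U\<^sub>i\<close> of diameter \<open>\<rho>\<^sub>i\<close> with \<open>\<Sum> \<rho>\<^sub>i\<^sup>p\<close> tiny, and pull them back to sets
  \<open>A\<^sub>i\<close> of diameter \<open>r\<^sub>i\<close> whose projections to \<open>Y\<close> are \<open>D\<^sub>i\<close>. Fix \<open>y\<close> and an exponent \<open>\<tau> < 1\<close>, and
  let \<open>T\<close> be a bounded piece of \<open>E\<close> to be chosen below. The slice \<open>T \<times> {y}\<close> is covered
  by the traces of the \<open>A\<^sub>i\<close> with \<open>y \<in> D\<^sub>i\<close>, which lie in intervals of radius
  \<open>r\<^sub>i\<close>. By the Vitali covering lemma in the line, a subfamily of these intervals has bounded total
  length and covers the slice after enlargement by a factor 5, and by quasisymmetry the images of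
  the enlarged traces still have diameter at most \<open>a\<^sub>i = K \<rho>\<^sub>i\<close>. The image of
  \<open>E \<times> {y}\<close> is quasisymmetric to \<open>E\<close>, so it has dimension at least 1; hence \<open>T\<close> can be chosen so
  that the image of \<open>T \<times> {y}\<close> has \<open>\<tau>\<close>-content larger than some \<open>c > 0\<close>.
  Then the sum of \<open>a\<^sub>i\<^sup>\<tau>\<close> over the subfamily exceeds \<open>c\<close>. The members with \<open>a\<^sub>i\<^sup>\<tau> \<le> \<kappa> r\<^sub>i\<close> contribute
  at most \<open>\<kappa>\<close> times the total length, which is at most \<open>c/2\<close> for a suitable \<open>\<kappa>\<close>. So those with
  \<open>a\<^sub>i\<^sup>\<tau> > \<kappa> r\<^sub>i\<close> and \<open>y \<in> D\<^sub>i\<close> satisfy \<open>\<Sum> a\<^sub>i\<^sup>\<tau> \<ge> c/2\<close>.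

  In other words the sets \<open>D\<^sub>i\<close> with weights \<open>a\<^sub>i\<^sup>\<tau>\<close> form a weighted cover of \<open>Y\<close>, of cost
  \<open>\<Sum> a\<^sub>i\<^sup>\<tau> r\<^sub>i\<^sup>s \<le> const \<Sum> a\<^sub>i\<^bsup>\<tau> + \<tau> s\<^esup>\<close>, and \<open>\<tau> + \<tau> s > p\<close> when \<open>\<tau>\<close> is close to 1. A weighted cover
  is turned into an ordinary one by grouping the sets according to the dyadic size of \<open>a\<^sub>i\<close>
  (\<open>exists_populous_dyadic_level\<close>): at the price of a factor \<open>a\<^sub>i\<^bsup>-\<sigma>\<^esup>\<close>, each \<open>y\<close> lies in many sets of
  one group, all of almost the same weight, and a point that lies in many members of a finite
  family is covered by enlargements of a light subfamily
  (\<open>light_subfamily_covering_multiple_points\<close>). Choosing \<open>\<sigma>\<close> with \<open>\<tau> - \<sigma> + \<tau> s \<ge> p\<close> finishes the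
  estimate (\<open>hausdorff_null_of_large_slices\<close>). The piece \<open>T\<close> and the constant \<open>c\<close>
  depend on \<open>y\<close>, but \<open>Y\<close> is a countable union of sets over each of which the same choice works.
\<close>

section \<open>Coverings and Hausdorff dimension\<close>

definition covers_with_diams ::
    "'a set \<Rightarrow> ('a \<Rightarrow> 'a \<Rightarrow> real) \<Rightarrow> (nat \<Rightarrow> 'a set) \<Rightarrow> (nat \<Rightarrow> real) \<Rightarrow> bool" where
  "covers_with_diams X d U r \<longleftrightarrow>
     X \<subseteq> (\<Union>i. U i) \<and> (\<forall>i. 0 \<le> r i) \<and> (\<forall>i. \<forall>x\<in>U i. \<forall>y\<in>U i. d x y \<le> r i)"

text \<open>A bound \<open>b\<close> on the \<open>s\<close>-dimensional Hausdorff content, which admits covers by sets of any size. The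
  cost is computed from numbers that dominate the diameters, so that these can be enlarged freely.\<close>

definition has_cover :: "'a set \<Rightarrow> ('a \<Rightarrow> 'a \<Rightarrow> real) \<Rightarrow> real \<Rightarrow> ennreal \<Rightarrow> bool" where
  "has_cover X d s b \<longleftrightarrow>
     (\<exists>U r. covers_with_diams X d U r \<and> (\<Sum>i. ennreal (r i powr s)) \<le> b)"

text \<open>For \<open>s > 0\<close> these are the sets of \<open>s\<close>-dimensional Hausdorff measure zero: a small sum
  of \<open>s\<close>-th powers forces all its terms to be small, so that covers of small cost are automatically
  fine.\<close>

definition hausdorff_null :: "real \<Rightarrow> 'a set \<Rightarrow> ('a \<Rightarrow> 'a \<Rightarrow> real) \<Rightarrow> bool" where
  "hausdorff_null s X d \<longleftrightarrow> (\<forall>\<epsilon>>0. has_cover X d s (ennreal \<epsilon>))"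

lemma covers_with_diamsI:
  assumes "X \<subseteq> (\<Union>i. U i)" "\<And>i. 0 \<le> r i"
    and "\<And>i x y. x \<in> U i \<Longrightarrow> y \<in> U i \<Longrightarrow> d x y \<le> r i"
  shows "covers_with_diams X d U r"
  using assms by (simp add: covers_with_diams_def)

lemma covers_with_diamsD:
  assumes "covers_with_diams X d U r"
  shows "X \<subseteq> (\<Union>i. U i)" "0 \<le> r i" "x \<in> U i \<Longrightarrow> y \<in> U i \<Longrightarrow> d x y \<le> r i"
  using assms by (simp_all add: covers_with_diams_def)

lemma has_coverI:
  assumes "covers_with_diams X d U r" "(\<Sum>i. ennreal (r i powr s)) \<le> b"
  shows "has_cover X d s b"
  using assms unfolding has_cover_def by blast

lemma has_coverE:
  assumes "has_cover X d s b"
  obtains U r where "covers_with_diams X d U r" "(\<Sum>i. ennreal (r i powr s)) \<le> b"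
  using assms unfolding has_cover_def by blast

lemma has_cover_mono:
  assumes "has_cover X d s b" "X' \<subseteq> X" "b \<le> b'"
  shows "has_cover X' d s b'"
proof -
  obtain U r where c: "covers_with_diams X d U r" and "(\<Sum>i. ennreal (r i powr s)) \<le> b"
    using assms(1) by (rule has_coverE)
  then have "covers_with_diams X' d U r" "(\<Sum>i. ennreal (r i powr s)) \<le> b'"
    using assms(2,3) subset_trans by (auto simp: covers_with_diams_def)
  then show ?thesis by (rule has_coverI)
qed

lemma hausdorff_nullD: "hausdorff_null s X d \<Longrightarrow> 0 < \<epsilon> \<Longrightarrow> has_cover X d s (ennreal \<epsilon>)"
  by (simp add: hausdorff_null_def)

lemma hausdorff_nullI: "(\<And>\<epsilon>. 0 < \<epsilon> \<Longrightarrow> has_cover X d s (ennreal \<epsilon>)) \<Longrightarrow> hausdorff_null s X d"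
  by (simp add: hausdorff_null_def)

lemma hausdorff_null_mono: "hausdorff_null s X d \<Longrightarrow> X' \<subseteq> X \<Longrightarrow> hausdorff_null s X' d"
  by (rule hausdorff_nullI, rule has_cover_mono[OF hausdorff_nullD]) auto

lemma hausdorff_null_empty: "hausdorff_null s {} d"
  by (auto intro!: hausdorff_nullI has_coverI[where U = "\<lambda>_. {}" and r = "\<lambda>_. 0"] covers_with_diamsI)

lemma has_cover_UN:
  fixes X :: "nat \<Rightarrow> 'a set"
  assumes "\<And>k. has_cover (X k) d s (b k)"
  shows "has_cover (\<Union>k. X k) d s (\<Sum>k. b k)"
proof -
  have "\<forall>k. \<exists>U r. covers_with_diams (X k) d U r \<and> (\<Sum>i. ennreal (r i powr s)) \<le> b k"
    using assms unfolding has_cover_def by blast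
  then obtain U r where U: "\<And>k. covers_with_diams (X k) d (U k) (r k)"
    and sum: "\<And>k. (\<Sum>i. ennreal (r k i powr s)) \<le> b k"
    by metis
  define V where "V n = (case prod_decode n of (k, i) \<Rightarrow> U k i)" for n
  define q where "q n = (case prod_decode n of (k, i) \<Rightarrow> r k i)" for n
  show ?thesis
  proof (rule has_coverI, rule covers_with_diamsI)
    show "(\<Union>k. X k) \<subseteq> (\<Union>n. V n)"
    proof
      fix x assume "x \<in> (\<Union>k. X k)"
      then obtain k i where "x \<in> U k i" using covers_with_diamsD(1)[OF U] by blast
      then have "x \<in> V (prod_encode (k, i))" by (simp add: V_def)
      then show "x \<in> (\<Union>n. V n)" by blast
    qed
    show "0 \<le> q n" for n
      using covers_with_diamsD(2)[OF U] by (simp add: q_def split: prod.split)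
    show "d x y \<le> q n" if "x \<in> V n" "y \<in> V n" for n x y
      using that covers_with_diamsD(3)[OF U] by (simp add: q_def V_def split: prod.splits)
    have "(\<Sum>n. (\<lambda>(k, i). ennreal (r k i powr s)) (prod_decode n)) =
        (\<Sum>k. \<Sum>i. ennreal (r k i powr s))"
      by (rule suminf_ennreal_2dimen) simp
    then have "(\<Sum>n. ennreal (q n powr s)) = (\<Sum>k. \<Sum>i. ennreal (r k i powr s))"
      by (simp add: q_def case_prod_unfold)
    also have "\<dots> \<le> (\<Sum>k. b k)"
      by (intro suminf_le sum) auto
    finally show "(\<Sum>n. ennreal (q n powr s)) \<le> (\<Sum>k. b k)" .
  qed
qed

lemma suminf_halves: "0 \<le> \<epsilon> \<Longrightarrow> (\<Sum>k. ennreal (\<epsilon> * (1 / 2) ^ Suc k)) = ennreal \<epsilon>"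
  using sums_mult[OF power_half_series, of \<epsilon>] by (intro suminf_ennreal_eq) auto

lemma hausdorff_null_UN:
  fixes X :: "nat \<Rightarrow> 'a set"
  assumes "\<And>k. hausdorff_null s (X k) d"
  shows "hausdorff_null s (\<Union>k. X k) d"
proof (rule hausdorff_nullI)
  fix \<epsilon> :: real assume "0 < \<epsilon>"
  then have "has_cover (X k) d s (ennreal (\<epsilon> * (1 / 2) ^ Suc k))" for k
    by (intro hausdorff_nullD assms) simp
  then have "has_cover (\<Union>k. X k) d s (\<Sum>k. ennreal (\<epsilon> * (1 / 2) ^ Suc k))"
    by (rule has_cover_UN)
  then show "has_cover (\<Union>k. X k) d s (ennreal \<epsilon>)"
    by (subst (asm) suminf_halves) (use \<open>0 < \<epsilon>\<close> in auto)
qed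

lemma ennreal_suminf_term_le: "(\<Sum>i. ennreal (f i)) \<le> ennreal b \<Longrightarrow> 0 \<le> b \<Longrightarrow> f i \<le> b"
proof -
  assume a: "(\<Sum>i. ennreal (f i)) \<le> ennreal b" "0 \<le> b"
  have "ennreal (f i) \<le> (\<Sum>i. ennreal (f i))"
    using sum_le_suminf[of "\<lambda>i. ennreal (f i)" "{i}"] by simp
  from order_trans[OF this a(1)] show ?thesis using a(2) by simp
qed

lemma suminf_powr_le_1D:
  assumes "(\<Sum>i. ennreal (r i powr s)) \<le> ennreal b" "0 \<le> b" "b \<le> 1" "0 < s"
  shows "r i \<le> 1"
proof -
  have "r i powr s \<le> 1"
    using ennreal_suminf_term_le[OF assms(1,2), of i] assms(3) by simp
  then show ?thesis
    using gr_one_powr[of "r i" s] \<open>0 < s\<close> by (meson linorder_not_le)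
qed

text \<open>Adding summable tiny amounts to the \<open>r\<^sub>i\<close> makes them positive, which allows singletons in the
  cover to be treated like all other sets.\<close>

lemma hausdorff_null_coverE:
  assumes "hausdorff_null s X d" "0 < s" "0 < \<epsilon>"
  obtains U r where "covers_with_diams X d U r" "\<And>i. 0 < r i" "(\<Sum>i. ennreal (r i powr s)) \<le> ennreal \<epsilon>"
proof -
  have "has_cover X d s (ennreal (\<epsilon> / 2))"
    by (rule hausdorff_nullD) (use assms in auto)
  then obtain U r where U: "covers_with_diams X d U r"
    and sum: "(\<Sum>i. ennreal (r i powr s)) \<le> ennreal (\<epsilon> / 2)"
    by (rule has_coverE)
  define q where "q i = max (r i) ((\<epsilon> / 2 * (1 / 2) ^ Suc i) powr (1 / s))" for i
  have pos: "0 < \<epsilon> / 2 * (1 / 2) ^ Suc i" for i using \<open>0 < \<epsilon>\<close> by simp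
  show ?thesis
  proof (rule that[of U q])
    show "covers_with_diams X d U q"
      using U by (auto simp: q_def covers_with_diams_def intro: max.coboundedI1)
    show "0 < q i" for i
      using \<open>0 < \<epsilon>\<close> by (auto simp: q_def less_max_iff_disj)
    have "q i powr s \<le> r i powr s + \<epsilon> / 2 * (1 / 2) ^ Suc i" for i
    proof (cases "r i \<le> (\<epsilon> / 2 * (1 / 2) ^ Suc i) powr (1 / s)")
      case True
      then have "q i powr s = \<epsilon> / 2 * (1 / 2) ^ Suc i"
        using pos[of i] \<open>0 < s\<close> by (simp add: q_def max_absorb2 powr_powr)
      then show ?thesis using powr_ge_zero[of "r i" s] by linarith
    next
      case False
      then show ?thesis using pos[of i] by (simp add: q_def max_absorb1)
    qed
    then have "(\<Sum>i. ennreal (q i powr s)) \<le>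
        (\<Sum>i. ennreal (r i powr s) + ennreal (\<epsilon> / 2 * (1 / 2) ^ Suc i))"
      using pos by (intro suminf_le) (auto simp flip: ennreal_plus simp: less_imp_le intro!: ennreal_leI)
    also have "\<dots> = (\<Sum>i. ennreal (r i powr s)) + (\<Sum>i. ennreal (\<epsilon> / 2 * (1 / 2) ^ Suc i))"
      by (rule suminf_add[symmetric]) auto
    also have "\<dots> \<le> ennreal (\<epsilon> / 2) + ennreal (\<epsilon> / 2)"
      by (rule add_mono[OF sum]) (subst suminf_halves, use \<open>0 < \<epsilon>\<close> in auto)
    also have "\<dots> = ennreal \<epsilon>" using \<open>0 < \<epsilon>\<close> by (simp flip: ennreal_plus)
    finally show "(\<Sum>i. ennreal (q i powr s)) \<le> ennreal \<epsilon>" .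
  qed
qed

lemma hausdorff_null_mono_exponent:
  assumes "hausdorff_null s X d" "0 < s" "s \<le> t"
  shows "hausdorff_null t X d"
proof (rule hausdorff_nullI)
  fix \<epsilon> :: real assume "0 < \<epsilon>"
  have "has_cover X d s (ennreal (min \<epsilon> 1))"
    by (rule hausdorff_nullD) (use assms \<open>0 < \<epsilon>\<close> in auto)
  then obtain U r where U: "covers_with_diams X d U r"
    and sum: "(\<Sum>i. ennreal (r i powr s)) \<le> ennreal (min \<epsilon> 1)"
    by (rule has_coverE)
  have le1: "r i \<le> 1" for i
    by (rule suminf_powr_le_1D[OF sum]) (use \<open>0 < \<epsilon>\<close> \<open>0 < s\<close> in auto)
  have "(\<Sum>i. ennreal (r i powr t)) \<le> (\<Sum>i. ennreal (r i powr s))"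
  proof (intro suminf_le ennreal_leI)
    show "r i powr t \<le> r i powr s" for i
      using le1[of i] covers_with_diamsD(2)[OF U, of i] \<open>s \<le> t\<close> by (cases "r i = 0") (auto intro: powr_mono')
  qed auto
  then have "(\<Sum>i. ennreal (r i powr t)) \<le> ennreal \<epsilon>"
    using sum by (meson ennreal_leI min.cobounded1 order_trans)
  then show "has_cover X d t (ennreal \<epsilon>)" by (rule has_coverI[OF U])
qed

lemma hausdorff_null_iff_hausdorff_measure_eq_0:
  assumes "0 < s"
  shows "hausdorff_null s X d \<longleftrightarrow> hausdorff_measure X d s = 0"
proof
  assume null: "hausdorff_null s X d"
  have "hausdorff_content X d s \<delta> \<le> ennreal \<epsilon>" if "0 < \<delta>" "0 < \<epsilon>" for \<delta> \<epsilon>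
  proof -
    have "0 < min \<epsilon> (\<delta> powr s)" using that by simp
    then have "has_cover X d s (ennreal (min \<epsilon> (\<delta> powr s)))"
      by (rule hausdorff_nullD[OF null])
    then obtain U r where U: "covers_with_diams X d U r"
    and sum: "(\<Sum>i. ennreal (r i powr s)) \<le> ennreal (min \<epsilon> (\<delta> powr s))"
      by (rule has_coverE)
    have "r i powr s \<le> \<delta> powr s" for i
      using ennreal_suminf_term_le[OF sum, of i] that by simp
    then have r\<delta>: "r i \<le> \<delta>" for i
      using powr_less_mono2[of s \<delta> "r i"] \<open>0 < s\<close> \<open>0 < \<delta>\<close> by (meson linorder_not_le less_imp_le)
    have diam: "ext_diameter d (U i \<inter> X) \<le> ennreal (r i)" for i
      unfolding ext_diameter_def using covers_with_diamsD(3)[OF U] by (intro SUP_least ennreal_leI) auto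
    have dp: "diameter_pow d s (U i \<inter> X) \<le> ennreal (r i powr s)" for i
    proof -
      have "enn2real (ext_diameter d (U i \<inter> X)) \<le> r i"
        using diam[of i] covers_with_diamsD(2)[OF U, of i] by (simp add: enn2real_leI)
      then show ?thesis
        using \<open>0 < s\<close> by (auto simp: diameter_pow_def intro!: ennreal_leI powr_mono2)
    qed
    have "hausdorff_content X d s \<delta> \<le> (\<Sum>i. diameter_pow d s (U i \<inter> X))"
      unfolding hausdorff_content_def
      using covers_with_diamsD(1)[OF U] order_trans[OF diam ennreal_leI[OF r\<delta>]] by (intro INF_lower) auto
    also have "\<dots> \<le> (\<Sum>i. ennreal (r i powr s))" by (intro suminf_le dp) auto
    also have "\<dots> \<le> ennreal \<epsilon>" using sum by (meson ennreal_leI min.cobounded1 order_trans)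
    finally show ?thesis .
  qed
  then have content: "hausdorff_content X d s \<delta> = 0" if "0 < \<delta>" for \<delta>
    using that ennreal_le_epsilon[of 0 "hausdorff_content X d s \<delta>"] by simp
  then show "hausdorff_measure X d s = 0"
    unfolding hausdorff_measure_def by (simp add: content cong: SUP_cong_simp)
next
  assume "hausdorff_measure X d s = 0"
  then have zero: "hausdorff_content X d s 1 = 0"
    using SUP_upper[of 1 "{0<..}" "hausdorff_content X d s"] unfolding hausdorff_measure_def by simp
  show "hausdorff_null s X d"
  proof (rule hausdorff_nullI)
    fix \<epsilon> :: real assume "0 < \<epsilon>"
    then have "hausdorff_content X d s 1 < ennreal \<epsilon>" using zero by simp
    then obtain U :: "nat \<Rightarrow> 'a set" where U: "\<And>i. ext_diameter d (U i) \<le> ennreal 1"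
      and X: "X \<subseteq> (\<Union>i. U i)" and sum: "(\<Sum>i. diameter_pow d s (U i)) < ennreal \<epsilon>"
      unfolding hausdorff_content_def INF_less_iff by auto
    define r where "r i = (if U i = {} then 0 else enn2real (ext_diameter d (U i)))" for i
    have fin: "ext_diameter d (U i) \<noteq> top" for i
      using U[of i] by (auto simp: top_unique)
    have eq: "diameter_pow d s (U i) = ennreal (r i powr s)" for i
      using \<open>0 < s\<close> by (simp add: diameter_pow_def r_def)
    show "has_cover X d s (ennreal \<epsilon>)"
    proof (rule has_coverI, rule covers_with_diamsI[OF X])
      show "0 \<le> r i" for i by (simp add: r_def)
      show "d x y \<le> r i" if "x \<in> U i" "y \<in> U i" for i x y
      proof -
        have "ennreal (d x y) \<le> ext_diameter d (U i)"
          unfolding ext_diameter_def using that by (meson SUP_upper order_trans)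
        then have "enn2real (ennreal (d x y)) \<le> enn2real (ext_diameter d (U i))"
          using fin[of i] by (intro enn2real_mono) (auto simp: less_top)
        then show ?thesis
          using that enn2real_nonneg[of "ext_diameter d (U i)"]
          by (cases "0 \<le> d x y") (auto simp: r_def simp del: enn2real_nonneg)
      qed
      show "(\<Sum>i. ennreal (r i powr s)) \<le> ennreal \<epsilon>"
        using sum by (simp add: eq)
    qed
  qed
qed

text \<open>The measure with exponent 0 counts points. This removes the case \<open>s = 0\<close> from the infimum
  that defines the dimension.\<close>

lemma hausdorff_measure_0_exponent:
  assumes "hausdorff_measure X d 0 = 0"
  shows "X = {}"
proof -
  have "hausdorff_content X d 0 1 = 0"
    using assms unfolding hausdorff_measure_def
    by (metis SUP_upper greaterThan_iff le_zero_eq zero_less_one)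
  then have "hausdorff_content X d 0 1 < ennreal 1" by simp
  then obtain U :: "nat \<Rightarrow> 'a set" where
    X: "X \<subseteq> (\<Union>i. U i)" and sum: "(\<Sum>i. diameter_pow d 0 (U i)) < 1"
    unfolding hausdorff_content_def INF_less_iff by auto
  have "U i = {}" for i
  proof (rule ccontr)
    assume "U i \<noteq> {}"
    then have "1 \<le> (\<Sum>i. diameter_pow d 0 (U i))"
      using sum_le_suminf[of "\<lambda>i. diameter_pow d 0 (U i)" "{i}"] by (simp add: diameter_pow_def)
    with sum show False by simp
  qed
  with X show ?thesis by auto
qed

lemma hausdorff_dim_le_of_hausdorff_null:
  "hausdorff_null s X d \<Longrightarrow> 0 < s \<Longrightarrow> hausdorff_dim X d \<le> ennreal s"
  unfolding hausdorff_dim_def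
  by (intro Inf_lower) (auto simp: hausdorff_null_iff_hausdorff_measure_eq_0)

lemma hausdorff_null_of_hausdorff_dim_less:
  assumes "hausdorff_dim X d < ennreal t"
  shows "hausdorff_null t X d"
proof -
  obtain s where s: "0 \<le> s" "s < t" "hausdorff_measure X d s = 0"
    using assms unfolding hausdorff_dim_def Inf_less_iff by (auto simp: ennreal_less_iff)
  show ?thesis
  proof (cases "s = 0")
    case True
    with s hausdorff_measure_0_exponent have "X = {}" by blast
    then show ?thesis by (simp add: hausdorff_null_empty)
  next
    case False
    with s show ?thesis
      using hausdorff_null_mono_exponent[of s X d t] by (auto simp: hausdorff_null_iff_hausdorff_measure_eq_0)
  qed
qed

section \<open>Products with a subset of the line, and measures of linear growth\<close>

lemma has_cover_onI:
  fixes J :: "nat set"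
  assumes "X \<subseteq> (\<Union>i\<in>J. U i)" "\<And>i. i \<in> J \<Longrightarrow> 0 \<le> r i"
    and "\<And>i x y. i \<in> J \<Longrightarrow> x \<in> U i \<Longrightarrow> y \<in> U i \<Longrightarrow> d x y \<le> r i"
    and sum: "(\<Sum>i. ennreal (r i powr s) * indicator J i) \<le> b"
  shows "has_cover X d s b"
proof (rule has_coverI[OF covers_with_diamsI])
  show "X \<subseteq> (\<Union>i. if i \<in> J then U i else {})" using assms(1) by auto
  have "(\<Sum>i. ennreal ((if i \<in> J then r i else 0) powr s)) =
      (\<Sum>i. ennreal (r i powr s) * indicator J i)"
    by (intro suminf_cong) (auto simp: indicator_def)
  with sum show "(\<Sum>i. ennreal ((if i \<in> J then r i else 0) powr s)) \<le> b" by simp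
qed (use assms in \<open>auto split: if_splits\<close>)

lemma suminf_indicator_finite:
  fixes f :: "nat \<Rightarrow> ennreal"
  assumes "finite F"
  shows "(\<Sum>i. f i * indicator F i) = sum f F"
proof -
  have "(\<Sum>i. f i * indicator F i) = (\<Sum>i\<in>F. f i * indicator F i)"
    by (rule suminf_finite[OF assms]) simp
  then show ?thesis by simp
qed

lemma has_cover_finiteI:
  fixes C :: "'i set"
  assumes C: "finite C" "X \<subseteq> (\<Union>i\<in>C. U i)" and r: "\<And>i. i \<in> C \<Longrightarrow> 0 \<le> r i"
    and d: "\<And>i x y. i \<in> C \<Longrightarrow> x \<in> U i \<Longrightarrow> y \<in> U i \<Longrightarrow> d x y \<le> r i"
    and sum: "(\<Sum>i\<in>C. r i powr s) \<le> b"
  shows "has_cover X d s (ennreal b)"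
proof -
  obtain h where h: "bij_betw h {0..<card C} C"
    using ex_bij_betw_nat_finite[OF \<open>finite C\<close>] by blast
  have mem: "h i \<in> C" if "i \<in> {0..<card C}" for i
    using h that by (auto simp: bij_betw_def)
  show ?thesis
  proof (rule has_cover_onI[where J = "{0..<card C}" and U = "\<lambda>i. U (h i)" and r = "\<lambda>i. r (h i)"])
    show "X \<subseteq> (\<Union>i\<in>{0..<card C}. U (h i))"
      using C(2) bij_betw_imp_surj_on[OF h] by (metis image_image)
    have "(\<Sum>i. ennreal (r (h i) powr s) * indicator {0..<card C} i) =
        (\<Sum>i\<in>{0..<card C}. ennreal (r (h i) powr s))"
      by (rule suminf_indicator_finite) simp
    also have "\<dots> = (\<Sum>i\<in>C. ennreal (r i powr s))"
      by (rule sum.reindex_bij_betw[OF h])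
    also have "\<dots> = ennreal (\<Sum>i\<in>C. r i powr s)"
      by (rule sum_ennreal) simp
    also have "\<dots> \<le> ennreal b" by (rule ennreal_leI[OF sum])
    finally show "(\<Sum>i. ennreal (r (h i) powr s) * indicator {0..<card C} i) \<le> ennreal b" .
  qed (use r d mem in auto)
qed

text \<open>An interval of length \<open>2L\<close> splits into about \<open>2L/r\<close> intervals of length \<open>r\<close>, each of which
  gives a product with \<open>U\<close> of diameter at most \<open>r\<close>.\<close>

lemma has_cover_interval_times:
  assumes "0 < r" "0 \<le> L" and diam: "\<And>y z. y \<in> U \<Longrightarrow> z \<in> U \<Longrightarrow> dY y z \<le> r"
  shows "has_cover ({-L..L} \<times> U) (max_dist dist dY) (1 + s) (ennreal ((2 * L + r) * r powr s))"
proof (rule has_cover_finiteI)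
  define M where "M = nat \<lfloor>2 * L / r\<rfloor>"
  let ?I = "\<lambda>j::nat. {-L + real j * r..-L + (real j + 1) * r}"
  have M: "real M \<le> 2 * L / r"
    using assms by (simp add: M_def)
  show "{-L..L} \<times> U \<subseteq> (\<Union>j\<in>{..M}. ?I j \<times> U)"
  proof
    fix p assume "p \<in> {-L..L} \<times> U"
    then obtain x y where p: "p = (x, y)" and x: "x \<in> {-L..L}" and y: "y \<in> U" by blast
    define j where "j = nat \<lfloor>(x + L) / r\<rfloor>"
    have nn: "0 \<le> (x + L) / r" using x \<open>0 < r\<close> by simp
    have "real j = of_int \<lfloor>(x + L) / r\<rfloor>"
      using nn by (simp add: j_def)
    then have "real j \<le> (x + L) / r" "(x + L) / r < real j + 1"
      by linarith+
    then have "x \<in> ?I j"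
      using \<open>0 < r\<close> by (simp add: field_simps)
    moreover have "(x + L) / r \<le> 2 * L / r"
      using x \<open>0 < r\<close> by (intro divide_right_mono) auto
    then have "j \<le> M" unfolding j_def M_def by (intro nat_mono floor_mono)
    ultimately show "p \<in> (\<Union>j\<in>{..M}. ?I j \<times> U)" using p y by blast
  qed
  show "max_dist dist dY p q \<le> r" if "p \<in> ?I j \<times> U" "q \<in> ?I j \<times> U" for j p q
    using that diam by (auto simp: max_dist_def dist_real_def algebra_simps)
  have "real (card {..M}) * r \<le> 2 * L + r"
    using M \<open>0 < r\<close> by (simp add: field_simps)
  then have "(real (card {..M}) * r) * r powr s \<le> (2 * L + r) * r powr s"
    by (rule mult_right_mono) simp
  then show "(\<Sum>j\<in>{..M}. r powr (1 + s)) \<le> (2 * L + r) * r powr s"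
    using \<open>0 < r\<close> by (simp add: powr_add mult.assoc)
qed (use assms in auto)

lemma hausdorff_null_times:
  fixes E :: "real set"
  assumes null: "hausdorff_null s Y dY" and "0 < s"
  shows "hausdorff_null (1 + s) (E \<times> Y) (max_dist dist dY)"
proof -
  have "hausdorff_null (1 + s) ({-real N..real N} \<times> Y) (max_dist dist dY)" for N :: nat
  proof (rule hausdorff_nullI)
    fix \<epsilon> :: real assume "0 < \<epsilon>"
    define L where "L = real N"
    have "0 \<le> L" by (simp add: L_def)
    define e where "e = min 1 (\<epsilon> / (2 * L + 1))"
    have e: "0 < e" "e \<le> 1"
      using \<open>0 < \<epsilon>\<close> \<open>0 \<le> L\<close> by (auto simp: e_def)
    have "(2 * L + 1) * e \<le> (2 * L + 1) * (\<epsilon> / (2 * L + 1))"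
      using \<open>0 \<le> L\<close> by (intro mult_left_mono) (auto simp: e_def)
    then have eL: "(2 * L + 1) * e \<le> \<epsilon>" using \<open>0 \<le> L\<close> by simp
    obtain U r where U: "covers_with_diams Y dY U r" and pos: "\<And>i. 0 < r i"
      and sum: "(\<Sum>i. ennreal (r i powr s)) \<le> ennreal e"
      using hausdorff_null_coverE[OF null \<open>0 < s\<close> \<open>0 < e\<close>] by blast
    have le1: "r i \<le> 1" for i
      by (rule suminf_powr_le_1D[OF sum]) (use e \<open>0 < s\<close> in auto)
    have "has_cover (\<Union>i. {-L..L} \<times> U i) (max_dist dist dY) (1 + s)
        (\<Sum>i. ennreal ((2 * L + r i) * r i powr s))"
      by (intro has_cover_UN has_cover_interval_times pos \<open>0 \<le> L\<close> covers_with_diamsD(3)[OF U])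
    moreover have "{-L..L} \<times> Y \<subseteq> (\<Union>i. {-L..L} \<times> U i)"
      using covers_with_diamsD(1)[OF U] by blast
    moreover have "(\<Sum>i. ennreal ((2 * L + r i) * r i powr s)) \<le> ennreal \<epsilon>"
    proof -
      have "(\<Sum>i. ennreal ((2 * L + r i) * r i powr s)) \<le>
          (\<Sum>i. ennreal (2 * L + 1) * ennreal (r i powr s))"
      proof (intro suminf_le)
        fix i
        have "(2 * L + r i) * r i powr s \<le> (2 * L + 1) * r i powr s"
          using le1[of i] by (intro mult_right_mono) auto
        then show "ennreal ((2 * L + r i) * r i powr s) \<le> ennreal (2 * L + 1) * ennreal (r i powr s)"
          using \<open>0 \<le> L\<close> by (subst ennreal_mult[symmetric]) (auto intro: ennreal_leI)
      qed auto
      also have "\<dots> = ennreal (2 * L + 1) * (\<Sum>i. ennreal (r i powr s))"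
        by (rule ennreal_suminf_cmult)
      also have "\<dots> \<le> ennreal (2 * L + 1) * ennreal e"
        by (rule mult_left_mono[OF sum]) simp
      also have "\<dots> \<le> ennreal \<epsilon>"
        using e eL \<open>0 \<le> L\<close> by (subst ennreal_mult[symmetric]) (auto intro: ennreal_leI)
      finally show ?thesis .
    qed
    ultimately show "has_cover ({-real N..real N} \<times> Y) (max_dist dist dY) (1 + s) (ennreal \<epsilon>)"
      unfolding L_def by (rule has_cover_mono)
  qed
  then have "hausdorff_null (1 + s) (\<Union>N. {-real N..real N} \<times> Y) (max_dist dist dY)"
    by (rule hausdorff_null_UN)
  moreover have "E \<times> Y \<subseteq> (\<Union>N. {-real N..real N} \<times> Y)"
  proof clarsimp
    fix x :: real and y assume "y \<in> Y"
    obtain N :: nat where "\<bar>x\<bar> \<le> real N" using real_arch_simple by blast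
    then show "\<exists>N::nat. - real N \<le> x \<and> x \<le> real N" by (intro exI[of _ N]) auto
  qed
  ultimately show ?thesis by (rule hausdorff_null_mono)
qed

text \<open>The mass distribution principle: a set of diameter at most \<open>r\<close> that meets \<open>E\<close> lies in a ball
  of radius \<open>2r\<close> around a point of \<open>E\<close>, so a cover of small cost has small measure.\<close>

lemma not_hausdorff_null_of_measure_growth:
  fixes lam :: "real measure"
  assumes sets: "sets lam = sets (restrict_space borel E)" and "0 < s" "0 < C"
    and upper: "\<And>x r. x \<in> E \<Longrightarrow> 0 < r \<Longrightarrow> r \<le> 1 \<Longrightarrow>
      emeasure lam (E \<inter> ball x r) \<le> ennreal (C * r powr s)"
    and lower: "0 < m" "ennreal m \<le> emeasure lam (E \<inter> ball a \<rho>)"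
  shows "\<not> hausdorff_null s E dist"
proof
  assume null: "hausdorff_null s E dist"
  define K where "K = C * 2 powr s"
  have "0 < K" using \<open>0 < C\<close> by (simp add: K_def)
  define e where "e = min ((1/2) powr s) (m / (2 * K))"
  have "0 < e" using \<open>0 < K\<close> \<open>0 < m\<close> by (simp add: e_def)
  have Ke: "K * e < m"
  proof -
    have "K * e \<le> K * (m / (2 * K))"
      using \<open>0 < K\<close> by (intro mult_left_mono) (auto simp: e_def)
    also have "\<dots> < m" using \<open>0 < K\<close> \<open>0 < m\<close> by simp
    finally show ?thesis .
  qed
  obtain U r where U: "covers_with_diams E dist U r" and pos: "\<And>i. 0 < r i"
    and sum: "(\<Sum>i. ennreal (r i powr s)) \<le> ennreal e"
    using hausdorff_null_coverE[OF null \<open>0 < s\<close> \<open>0 < e\<close>] by blast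
  have "r i powr s \<le> (1/2) powr s" for i
    using ennreal_suminf_term_le[OF sum, of i] \<open>0 < e\<close> by (simp add: e_def)
  then have half: "r i \<le> 1/2" for i
    using powr_less_mono2[of s "1/2" "r i"] \<open>0 < s\<close> by (meson linorder_not_le less_imp_le half_gt_zero zero_less_one)
  define c where "c i = (SOME x. x \<in> U i \<inter> E)" for i
  define B where "B i = (if U i \<inter> E = {} then {} else E \<inter> ball (c i) (2 * r i))" for i
  have c: "c i \<in> U i \<inter> E" if "U i \<inter> E \<noteq> {}" for i
    using that unfolding c_def by (meson ex_in_conv someI_ex)
  have ball_sets: "E \<inter> ball x q \<in> sets lam" for x q
    unfolding sets by (auto simp: sets_restrict_space)
  have B_sets: "B i \<in> sets lam" for i
    by (simp add: B_def ball_sets)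
  have "E \<subseteq> (\<Union>i. B i)"
  proof
    fix x assume "x \<in> E"
    then obtain i where i: "x \<in> U i" using covers_with_diamsD(1)[OF U] by blast
    with \<open>x \<in> E\<close> have ne: "U i \<inter> E \<noteq> {}" by blast
    then have "dist (c i) x \<le> r i" using c i covers_with_diamsD(3)[OF U] by blast
    then have "dist (c i) x < 2 * r i" using pos[of i] by linarith
    with \<open>x \<in> E\<close> ne show "x \<in> (\<Union>i. B i)" by (auto simp: B_def)
  qed
  then have "E \<inter> ball a \<rho> \<subseteq> (\<Union>i. B i)" by blast
  then have "emeasure lam (E \<inter> ball a \<rho>) \<le> emeasure lam (\<Union>i. B i)"
    using B_sets by (intro emeasure_mono) auto
  also have "\<dots> \<le> (\<Sum>i. emeasure lam (B i))"
    using B_sets by (intro emeasure_subadditive_countably) auto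
  also have "\<dots> \<le> (\<Sum>i. ennreal K * ennreal (r i powr s))"
  proof (intro suminf_le)
    show "emeasure lam (B i) \<le> ennreal K * ennreal (r i powr s)" for i
    proof (cases "U i \<inter> E = {}")
      case False
      then have "emeasure lam (B i) \<le> ennreal (C * (2 * r i) powr s)"
        using c half[of i] pos[of i] by (auto simp: B_def intro!: upper)
      also have "C * (2 * r i) powr s = K * r i powr s"
        using pos[of i] by (simp add: K_def powr_mult)
      finally show ?thesis using \<open>0 < K\<close> by (simp add: ennreal_mult)
    qed (simp add: B_def)
  qed auto
  also have "\<dots> = ennreal K * (\<Sum>i. ennreal (r i powr s))"
    by (rule ennreal_suminf_cmult)
  also have "\<dots> \<le> ennreal K * ennreal e"
    by (rule mult_left_mono[OF sum]) simp
  also have "\<dots> < ennreal m"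
    using Ke \<open>0 < K\<close> \<open>0 < e\<close> by (simp flip: ennreal_mult add: ennreal_less_iff)
  finally show False using lower(2) by simp
qed

section \<open>Covering lemmas\<close>

text \<open>By the Vitali covering lemma there are disjoint intervals among those of positive length whose
  enlargements cover the union; they lie in \<open>[-(L + B), L + B]\<close>, which bounds their total length.
  The degenerate intervals are all kept, since they add nothing to the length.\<close>

lemma interval_subcover:
  fixes x r :: "nat \<Rightarrow> real"
  assumes cover: "E \<subseteq> (\<Union>i\<in>J. cball (x i) (r i))"
    and x: "\<And>i. i \<in> J \<Longrightarrow> \<bar>x i\<bar> \<le> L" and r: "\<And>i. i \<in> J \<Longrightarrow> 0 \<le> r i" "\<And>i. i \<in> J \<Longrightarrow> r i \<le> B"
    and "0 \<le> L" "0 \<le> B"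
  obtains J' where "J' \<subseteq> J" "E \<subseteq> (\<Union>i\<in>J'. cball (x i) (5 * r i))"
    "(\<Sum>i. ennreal (r i) * indicator J' i) \<le> ennreal (L + B)"
proof -
  define J0 where "J0 = {i \<in> J. r i = 0}"
  define Jp where "Jp = {i \<in> J. 0 < r i}"
  obtain C where C: "C \<subseteq> Jp"
    and disj: "pairwise (\<lambda>i j. disjnt (cball (x i) (r i)) (cball (x j) (r j))) C"
    and cov: "(\<Union>i\<in>Jp. cball (x i) (r i)) \<subseteq> (\<Union>i\<in>C. cball (x i) (5 * r i))"
    by (rule Vitali_covering_lemma_cballs[where S = "\<Union>i\<in>Jp. cball (x i) (r i)" and K = Jp and a = x and r = r and B = B])
      (use r in \<open>auto simp: Jp_def\<close>)
  show ?thesis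
  proof
    show "C \<union> J0 \<subseteq> J" using C by (auto simp: Jp_def J0_def)
    show "E \<subseteq> (\<Union>i\<in>C \<union> J0. cball (x i) (5 * r i))"
    proof
      fix z assume "z \<in> E"
      then obtain i where i: "i \<in> J" "z \<in> cball (x i) (r i)" using cover by blast
      show "z \<in> (\<Union>i\<in>C \<union> J0. cball (x i) (5 * r i))"
      proof (cases "r i = 0")
        case True
        then have "i \<in> J0" "z \<in> cball (x i) (5 * r i)" using i by (auto simp: J0_def)
        then show ?thesis by blast
      next
        case False
        then have "i \<in> Jp" using i(1) r(1)[of i] by (simp add: Jp_def)
        then show ?thesis using i(2) cov by blast
      qed
    qed
    have "ennreal 2 * (\<Sum>i. ennreal (r i) * indicator (C \<union> J0) i) =
        (\<Sum>i. ennreal 2 * (ennreal (r i) * indicator (C \<union> J0) i))"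
      by (rule ennreal_suminf_cmult[symmetric])
    also have "\<dots> = (\<Sum>i. emeasure lborel (if i \<in> C then cball (x i) (r i) else {}))"
    proof (intro suminf_cong)
      fix i
      show "ennreal 2 * (ennreal (r i) * indicator (C \<union> J0) i) =
          emeasure lborel (if i \<in> C then cball (x i) (r i) else {})"
      proof (cases "i \<in> C")
        case True
        then have "0 \<le> r i" using C by (auto simp: Jp_def)
        then have "emeasure lborel (cball (x i) (r i)) = ennreal (2 * r i)"
          by (simp add: cball_eq_atLeastAtMost)
        with True \<open>0 \<le> r i\<close> show ?thesis by (simp add: ennreal_mult)
      next
        case False
        then show ?thesis by (auto simp: J0_def indicator_def)
      qed
    qed
    also have "\<dots> = emeasure lborel (\<Union>i. if i \<in> C then cball (x i) (r i) else {})"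
      by (rule suminf_emeasure)
        (use disj in \<open>auto simp: disjoint_family_on_def pairwise_def disjnt_def\<close>)
    also have "\<dots> \<le> emeasure lborel {-(L + B)..L + B}"
    proof (rule emeasure_mono)
      show "(\<Union>i. if i \<in> C then cball (x i) (r i) else {}) \<subseteq> {-(L + B)..L + B}"
      proof
        fix z assume "z \<in> (\<Union>i. if i \<in> C then cball (x i) (r i) else {})"
        then obtain i where "i \<in> C" "\<bar>x i - z\<bar> \<le> r i"
          by (auto simp: dist_real_def split: if_splits)
        moreover from \<open>i \<in> C\<close> have "i \<in> J" using C by (auto simp: Jp_def)
        ultimately have "\<bar>x i - z\<bar> \<le> B" "\<bar>x i\<bar> \<le> L"
          using x[of i] r(2)[of i] by linarith+
        then show "z \<in> {-(L + B)..L + B}"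
          unfolding atLeastAtMost_iff by linarith
      qed
    qed simp
    also have "\<dots> = ennreal (L + B - -(L + B))"
      using \<open>0 \<le> L\<close> \<open>0 \<le> B\<close> by (intro emeasure_lborel_Icc) linarith
    also have "L + B - -(L + B) = 2 * (L + B)" by simp
    also have "ennreal \<dots> = ennreal 2 * ennreal (L + B)"
      using \<open>0 \<le> L\<close> \<open>0 \<le> B\<close> by (intro ennreal_mult) linarith+
    finally show "(\<Sum>i. ennreal (r i) * indicator (C \<union> J0) i) \<le> ennreal (L + B)"
      by (simp add: ennreal_mult_le_mult_iff)
  qed
qed

text \<open>Greedy selection: take a set with the largest \<open>r\<close>, discard everything that meets it, repeat.\<close>

lemma disjoint_subfamily_dominating:
  fixes D :: "'i \<Rightarrow> 'a set" and r :: "'i \<Rightarrow> real"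
  assumes "finite F"
  shows "\<exists>C\<subseteq>F. disjoint_family_on D C \<and>
    (\<forall>i\<in>F. D i \<noteq> {} \<longrightarrow> (\<exists>j\<in>C. D i \<inter> D j \<noteq> {} \<and> r i \<le> r j))"
  using assms
proof (induction F rule: finite_psubset_induct)
  case (psubset F)
  show ?case
  proof (cases "F = {}")
    case False
    have "Max (r ` F) \<in> r ` F" using \<open>finite F\<close> False by simp
    then obtain k where k: "k \<in> F" "r k = Max (r ` F)" by auto
    then have max: "r i \<le> r k" if "i \<in> F" for i using that \<open>finite F\<close> by simp
    define F' where "F' = {i \<in> F. i \<noteq> k \<and> D i \<inter> D k = {}}"
    have "F' \<subset> F" using k by (auto simp: F'_def)
    then obtain C where C: "C \<subseteq> F'" "disjoint_family_on D C"
      and dom: "\<And>i. i \<in> F' \<Longrightarrow> D i \<noteq> {} \<Longrightarrow> \<exists>j\<in>C. D i \<inter> D j \<noteq> {} \<and> r i \<le> r j"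
      using psubset.IH[OF \<open>F' \<subset> F\<close>] by blast
    have "\<exists>j\<in>insert k C. D i \<inter> D j \<noteq> {} \<and> r i \<le> r j" if "i \<in> F" "D i \<noteq> {}" for i
    proof (cases "i \<in> F'")
      case True
      then show ?thesis using dom that by blast
    next
      case False
      then have "D i \<inter> D k \<noteq> {}" using that by (auto simp: F'_def)
      then show ?thesis using max that by blast
    qed
    moreover have "disjoint_family_on D (insert k C)"
      using C by (auto simp: disjoint_family_on_def F'_def)
    ultimately show ?thesis
      using C \<open>F' \<subset> F\<close> k by (intro exI[of _ "insert k C"]) auto
  qed (auto simp: disjoint_family_on_def)
qed

text \<open>Select \<open>m\<close> disjoint dominating subfamilies one after another, each from what the previous ones
  left. A point loses at most one of its sets to each of them, so a point in at least \<open>m\<close> sets is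
  covered by every one of the \<open>m\<close> subfamilies. Their total weight is at most that of the family,
  so the lightest one has at most an \<open>m\<close>-th of it. The induction on \<open>m\<close> keeps the lighter of the
  first subfamily and the best of the later ones.\<close>

lemma light_subfamily_covering_multiple_points:
  fixes D :: "'i \<Rightarrow> 'a set" and r g :: "'i \<Rightarrow> real"
  assumes "finite F" "\<And>i. i \<in> F \<Longrightarrow> 0 \<le> g i" "0 < m"
  shows "\<exists>C\<subseteq>F. real m * sum g C \<le> sum g F \<and>
    (\<forall>y. m \<le> card {i \<in> F. y \<in> D i} \<longrightarrow>
      (\<exists>i\<in>F. \<exists>j\<in>C. y \<in> D i \<and> D i \<inter> D j \<noteq> {} \<and> r i \<le> r j))"
  using \<open>0 < m\<close> assms(1,2)
proof (induction m arbitrary: F rule: nat_induct_non_zero)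
  have single: "\<exists>i\<in>F. \<exists>j\<in>C. y \<in> D i \<and> D i \<inter> D j \<noteq> {} \<and> r i \<le> r j"
    if C: "\<forall>i\<in>F. D i \<noteq> {} \<longrightarrow> (\<exists>j\<in>C. D i \<inter> D j \<noteq> {} \<and> r i \<le> r j)"
      and "0 < card {i \<in> F. y \<in> D i}" for F C y
  proof -
    have "{i \<in> F. y \<in> D i} \<noteq> {}" using that(2) by (metis card.empty less_irrefl)
    then obtain i where "i \<in> F" "y \<in> D i" by blast
    then show ?thesis using C by blast
  qed
  {
    case 1
    obtain C where C: "C \<subseteq> F" "\<forall>i\<in>F. D i \<noteq> {} \<longrightarrow> (\<exists>j\<in>C. D i \<inter> D j \<noteq> {} \<and> r i \<le> r j)"
      using disjoint_subfamily_dominating[OF \<open>finite F\<close>, of D r] by blast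
    have "sum g C \<le> sum g F" using C 1 by (intro sum_mono2) auto
    then show ?case
      using C(1) single[OF C(2)] by (intro exI[of _ C]) simp
  next
    case (Suc m)
    obtain C where C: "C \<subseteq> F" "disjoint_family_on D C"
      and dom: "\<forall>i\<in>F. D i \<noteq> {} \<longrightarrow> (\<exists>j\<in>C. D i \<inter> D j \<noteq> {} \<and> r i \<le> r j)"
      using disjoint_subfamily_dominating[OF \<open>finite F\<close>, of D r] by blast
    obtain C' where C': "C' \<subseteq> F - C" "real m * sum g C' \<le> sum g (F - C)"
      and cov: "\<And>y. m \<le> card {i \<in> F - C. y \<in> D i} \<Longrightarrow>
        \<exists>i\<in>F - C. \<exists>j\<in>C'. y \<in> D i \<and> D i \<inter> D j \<noteq> {} \<and> r i \<le> r j"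
      using Suc.IH[of "F - C"] Suc.prems by auto
    have split: "sum g F = sum g (F - C) + sum g C"
      by (rule sum.subset_diff[OF \<open>C \<subseteq> F\<close> \<open>finite F\<close>])
    show ?case
    proof (cases "sum g C \<le> sum g C'")
      case True
      then have "real m * sum g C \<le> real m * sum g C'" by (intro mult_left_mono) auto
      then have "real (Suc m) * sum g C \<le> sum g F"
        using C'(2) split by (simp add: algebra_simps)
      then show ?thesis
        using C(1) single[OF dom] by (intro exI[of _ C]) auto
    next
      case False
      then have le: "real (Suc m) * sum g C' \<le> sum g F"
        using C'(2) split by (simp add: algebra_simps)
      have "\<exists>i\<in>F. \<exists>j\<in>C'. y \<in> D i \<and> D i \<inter> D j \<noteq> {} \<and> r i \<le> r j"
        if y: "Suc m \<le> card {i \<in> F. y \<in> D i}" for y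
      proof -
        have fin: "finite {i \<in> C. y \<in> D i}" "finite {i \<in> F - C. y \<in> D i}"
          using finite_subset[OF C(1) \<open>finite F\<close>] \<open>finite F\<close> by simp_all
        have "card {i \<in> C. y \<in> D i} \<le> Suc 0"
          using C(2) unfolding card_le_Suc0_iff_eq[OF fin(1)] disjoint_family_on_def by blast
        moreover have "{i \<in> F. y \<in> D i} = {i \<in> F - C. y \<in> D i} \<union> {i \<in> C. y \<in> D i}"
          using \<open>C \<subseteq> F\<close> by blast
        then have "card {i \<in> F. y \<in> D i} \<le> card {i \<in> F - C. y \<in> D i} + card {i \<in> C. y \<in> D i}"
          by (simp add: card_Un_le)
        ultimately have "m \<le> card {i \<in> F - C. y \<in> D i}" using y by linarith
        then show ?thesis using cov by blast
      qed
      then show ?thesis using C' le by (intro exI[of _ C']) auto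
    qed
  }
qed

text \<open>If \<open>D\<^sub>i\<close> meets \<open>D\<^sub>j\<close> and \<open>r\<^sub>i \<le> r\<^sub>j\<close>, then \<open>D\<^sub>i\<close> lies in the \<open>r\<^sub>j\<close>-neighbourhood of \<open>D\<^sub>j\<close>, whose
  diameter is at most \<open>3 r\<^sub>j\<close>. The bound \<open>1/b\<close> in the cost is what multiplicity \<open>b\<close> buys.\<close>

lemma (in Metric_space) has_cover_multiple_points:
  assumes F: "finite F" "\<And>i. i \<in> F \<Longrightarrow> D i \<subseteq> M" "\<And>i. i \<in> F \<Longrightarrow> 0 \<le> r i"
    and diam: "\<And>i x y. i \<in> F \<Longrightarrow> x \<in> D i \<Longrightarrow> y \<in> D i \<Longrightarrow> d x y \<le> r i"
    and "0 < b"
  shows "has_cover {y. b \<le> real (card {i \<in> F. y \<in> D i})} d s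
    (ennreal (3 powr s / b * (\<Sum>i\<in>F. r i powr s)))"
proof -
  define m where "m = nat \<lceil>b\<rceil>"
  have m: "0 < m" "b \<le> real m" using \<open>0 < b\<close> by (auto simp: m_def)
  obtain C where C: "C \<subseteq> F" and sum: "real m * (\<Sum>i\<in>C. r i powr s) \<le> (\<Sum>i\<in>F. r i powr s)"
    and cov: "\<And>y. m \<le> card {i \<in> F. y \<in> D i} \<Longrightarrow>
      \<exists>i\<in>F. \<exists>j\<in>C. y \<in> D i \<and> D i \<inter> D j \<noteq> {} \<and> r i \<le> r j"
    using light_subfamily_covering_multiple_points[OF \<open>finite F\<close> _ \<open>0 < m\<close>, of "\<lambda>i. r i powr s" D r]
    by auto
  define N where "N j = {y \<in> M. \<exists>z\<in>D j. d y z \<le> r j}" for j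
  show ?thesis
  proof (rule has_cover_finiteI[where U = N and r = "\<lambda>j. 3 * r j"])
    show "finite C" using C \<open>finite F\<close> by (rule finite_subset)
    show "{y. b \<le> real (card {i \<in> F. y \<in> D i})} \<subseteq> (\<Union>j\<in>C. N j)"
    proof
      fix y assume "y \<in> {y. b \<le> real (card {i \<in> F. y \<in> D i})}"
      then have "m \<le> card {i \<in> F. y \<in> D i}" unfolding m_def by (simp add: nat_le_iff ceiling_le_iff)
      then obtain i j z where i: "i \<in> F" "y \<in> D i" and j: "j \<in> C" and z: "z \<in> D i" "z \<in> D j"
        and "r i \<le> r j"
        using cov by blast
      then have "d y z \<le> r j" using diam[of i y z] by linarith
      then have "y \<in> N j" using i F(2) z by (auto simp: N_def)
      with j show "y \<in> (\<Union>j\<in>C. N j)" by blast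
    qed
    show "0 \<le> 3 * r i" if "i \<in> C" for i using that C F(3) by auto
    show "d x y \<le> 3 * r j" if jN: "j \<in> C" "x \<in> N j" "y \<in> N j" for j x y
    proof -
      obtain u v where u: "u \<in> D j" "d x u \<le> r j" and v: "v \<in> D j" "d y v \<le> r j"
        and "x \<in> M" "y \<in> M"
        using jN unfolding N_def by blast
      have "j \<in> F" using jN C by blast
      then have "u \<in> M" "v \<in> M" "d u v \<le> r j" using F(2) u v diam by auto
      then have "d x y \<le> d x u + d u v + d v y"
        using triangle[of x u y] triangle[of u v y] \<open>x \<in> M\<close> \<open>y \<in> M\<close> by linarith
      then show ?thesis using u v \<open>d u v \<le> r j\<close> commute[of y v] by linarith
    qed
    have "b * (\<Sum>i\<in>C. r i powr s) \<le> real m * (\<Sum>i\<in>C. r i powr s)"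
      using m by (intro mult_right_mono sum_nonneg) auto
    then have "(\<Sum>i\<in>C. r i powr s) \<le> (\<Sum>i\<in>F. r i powr s) / b"
      using sum \<open>0 < b\<close> by (simp add: field_simps)
    then have "3 powr s * (\<Sum>i\<in>C. r i powr s) \<le> 3 powr s * ((\<Sum>i\<in>F. r i powr s) / b)"
      by (intro mult_left_mono) auto
    moreover have "(\<Sum>i\<in>C. (3 * r i) powr s) = 3 powr s * (\<Sum>i\<in>C. r i powr s)"
      using C F(3) by (auto simp: sum_distrib_left powr_mult intro!: sum.cong)
    ultimately show "(\<Sum>i\<in>C. (3 * r i) powr s) \<le> 3 powr s / b * (\<Sum>i\<in>F. r i powr s)"
      by simp
  qed
qed

section \<open>Dyadic pigeonholing of sums\<close>

lemma suminf_indicator_UN: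
  fixes f :: "nat \<Rightarrow> ennreal" and A :: "nat \<Rightarrow> nat set"
  assumes "disjoint_family A"
  shows "(\<Sum>k. \<Sum>i. f i * indicator (A k) i) = (\<Sum>i. f i * indicator (\<Union>k. A k) i)"
  using nn_integral_disjoint_family[of f "count_space UNIV" A] assms
  by (simp add: nn_integral_count_space_nat)

lemma finite_ge_of_suminf_powr:
  fixes a :: "nat \<Rightarrow> real"
  assumes "(\<Sum>i. ennreal (a i powr p)) \<le> ennreal C" "0 < p" "0 < \<beta>"
  shows "finite {i. \<beta> \<le> a i}"
proof -
  have "summable (\<lambda>i. a i powr p)"
    using assms(1) by (intro summable_suminf_not_top) (auto simp: top_unique)
  then have "(\<lambda>i. a i powr p) \<longlonglongrightarrow> 0" by (rule summable_LIMSEQ_zero)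
  then have "\<forall>\<^sub>F i in sequentially. a i powr p < \<beta> powr p"
    by (rule order_tendstoD) (use assms in simp)
  then obtain N where N: "\<And>i. N \<le> i \<Longrightarrow> a i powr p < \<beta> powr p"
    unfolding eventually_sequentially by blast
  have "{i. \<beta> \<le> a i} \<subseteq> {..<N}"
  proof
    fix i assume "i \<in> {i. \<beta> \<le> a i}"
    then have "\<beta> powr p \<le> a i powr p" using assms by (intro powr_mono2) auto
    then show "i \<in> {..<N}" using N[of i] by (meson lessThan_iff not_le)
  qed
  then show ?thesis by (rule finite_subset) simp
qed

definition dyadic_level :: "real \<Rightarrow> nat" where
  "dyadic_level x = nat \<lfloor>- log 2 x\<rfloor>"

lemma dyadic_level_bounds:
  assumes "0 < x" "x \<le> 1"
  shows "x \<le> 2 powr - real (dyadic_level x)" "2 powr - (real (dyadic_level x) + 1) \<le> x"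
proof -
  have "0 \<le> - log 2 x" using assms by simp
  then have "real (dyadic_level x) \<le> - log 2 x" "- log 2 x \<le> real (dyadic_level x) + 1"
    unfolding dyadic_level_def by linarith+
  then have "log 2 x \<le> - real (dyadic_level x)" "- (real (dyadic_level x) + 1) \<le> log 2 x"
    by linarith+
  then show "x \<le> 2 powr - real (dyadic_level x)" "2 powr - (real (dyadic_level x) + 1) \<le> x"
    using assms by (simp_all add: log_le_iff le_log_iff)
qed

text \<open>If every level \<open>k\<close> had fewer members than claimed, it would contribute at most a multiple of
  \<open>2\<^bsup>-\<sigma>k\<^esup>\<close> to the sum, because its members are at most \<open>2\<^bsup>-k\<^esup>\<close>; the factor in front is chosen so
  that the geometric series adds up to only half of \<open>c\<close>.\<close>

lemma exists_populous_dyadic_level: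
  fixes a :: "nat \<Rightarrow> real"
  assumes a: "\<And>i. 0 < a i" "\<And>i. a i \<le> 1" and fin: "\<And>\<beta>. 0 < \<beta> \<Longrightarrow> finite {i. \<beta> \<le> a i}"
    and "0 < \<sigma>" "0 < \<tau>" "0 < c"
    and sum: "ennreal c \<le> (\<Sum>i. ennreal (a i powr \<tau>) * indicator S i)"
  shows "\<exists>k. c / 2 * (1 - 2 powr - \<sigma>) * 2 powr ((\<tau> - \<sigma>) * real k) \<le>
    real (card {i \<in> S. dyadic_level (a i) = k})"
proof (rule ccontr)
  define q where "q = 2 powr - \<sigma>"
  have q: "0 < q" "q < 1" using \<open>0 < \<sigma>\<close> powr_less_mono[of "- \<sigma>" 0 2] by (auto simp: q_def)
  define A where "A k = {i \<in> S. dyadic_level (a i) = k}" for k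
  assume "\<not> ?thesis"
  then have small: "real (card (A k)) < c / 2 * (1 - q) * 2 powr ((\<tau> - \<sigma>) * real k)" for k
    by (auto simp: A_def q_def not_le)
  have finA: "finite (A k)" for k
  proof (rule finite_subset)
    show "A k \<subseteq> {i. 2 powr - (real k + 1) \<le> a i}"
      using dyadic_level_bounds(2)[OF a] by (auto simp: A_def)
  qed (simp add: fin)
  have "disjoint_family A" by (auto simp: disjoint_family_on_def A_def)
  have "(\<Union>k. A k) = S" by (auto simp: A_def)
  then have "(\<Sum>i. ennreal (a i powr \<tau>) * indicator S i) =
      (\<Sum>i. ennreal (a i powr \<tau>) * indicator (\<Union>k. A k) i)"
    by simp
  also have "\<dots> = (\<Sum>k. \<Sum>i. ennreal (a i powr \<tau>) * indicator (A k) i)"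
    by (rule suminf_indicator_UN[symmetric]) fact
  also have "\<dots> = (\<Sum>k. \<Sum>i\<in>A k. ennreal (a i powr \<tau>))"
    by (intro suminf_cong suminf_indicator_finite finA)
  also have "\<dots> \<le> (\<Sum>k. ennreal (c / 2 * (1 - q) * q ^ k))"
  proof (intro suminf_le)
    fix k
    have "(\<Sum>i\<in>A k. a i powr \<tau>) \<le> (\<Sum>i\<in>A k. (2 powr - real k) powr \<tau>)"
      using dyadic_level_bounds(1)[OF a] a \<open>0 < \<tau>\<close>
      by (intro sum_mono powr_mono2) (auto simp: A_def less_imp_le)
    also have "\<dots> = real (card (A k)) * 2 powr (- \<tau> * real k)"
      by (simp add: powr_powr mult.commute)
    also have "\<dots> \<le> (c / 2 * (1 - q) * 2 powr ((\<tau> - \<sigma>) * real k)) * 2 powr (- \<tau> * real k)"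
      using small[of k] by (intro mult_right_mono) auto
    also have "\<dots> = c / 2 * (1 - q) * 2 powr ((\<tau> - \<sigma>) * real k + - \<tau> * real k)"
      by (simp only: powr_add mult.assoc)
    also have "(\<tau> - \<sigma>) * real k + - \<tau> * real k = - \<sigma> * real k" by (simp add: algebra_simps)
    also have "2 powr (- \<sigma> * real k) = q ^ k"
      by (simp add: q_def powr_powr flip: powr_realpow)
    finally have "ennreal (\<Sum>i\<in>A k. a i powr \<tau>) \<le> ennreal (c / 2 * (1 - q) * q ^ k)"
      by (rule ennreal_leI)
    then show "(\<Sum>i\<in>A k. ennreal (a i powr \<tau>)) \<le> ennreal (c / 2 * (1 - q) * q ^ k)"
      by (subst sum_ennreal) auto
  qed auto
  also have "\<dots> = ennreal (c / 2 * (1 - q) * (1 / (1 - q)))"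
    using q \<open>0 < c\<close> by (intro suminf_ennreal_eq sums_mult geometric_sums) auto
  also have "c / 2 * (1 - q) * (1 / (1 - q)) = c / 2"
    unfolding times_divide_eq_right mult_1_right
    by (rule nonzero_mult_div_cancel_right) (use q in simp)
  finally have "ennreal c \<le> ennreal (c / 2)" using sum by (rule order_trans[rotated])
  with \<open>0 < c\<close> show False by simp
qed

text \<open>The supremum of the distances may fail to be attained, but half of it is exceeded if it is positive. For the empty
  set the value 0 serves.\<close>

lemma exists_half_attained_diameter:
  assumes bdd: "\<And>u v. u \<in> A \<Longrightarrow> v \<in> A \<Longrightarrow> d u v \<le> B" and nn: "\<And>u v. 0 \<le> d u v" and "0 \<le> (B::real)"
  shows "\<exists>r. 0 \<le> r \<and> r \<le> B \<and> (\<forall>u\<in>A. \<forall>v\<in>A. d u v \<le> r) \<and> (0 < r \<longrightarrow> (\<exists>u\<in>A. \<exists>v\<in>A. r \<le> 2 * d u v))"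
proof (cases "A = {}")
  case True
  then show ?thesis using \<open>0 \<le> B\<close> by (intro exI[of _ 0]) auto
next
  case False
  define R where "R = (\<lambda>(u, v). d u v) ` (A \<times> A)"
  have R: "R \<noteq> {}" "bdd_above R" using False bdd by (auto simp: R_def intro!: bdd_aboveI[of _ B])
  define r where "r = Sup R"
  have le: "d u v \<le> r" if "u \<in> A" "v \<in> A" for u v
    unfolding r_def by (rule cSup_upper[OF _ R(2)]) (use that in \<open>force simp: R_def\<close>)
  have "r \<le> B" unfolding r_def by (rule cSup_least[OF R(1)]) (use bdd in \<open>auto simp: R_def\<close>)
  moreover have "0 \<le> r" using False le nn by (meson ex_in_conv order_trans)
  moreover have "\<exists>u\<in>A. \<exists>v\<in>A. r \<le> 2 * d u v" if "0 < r"
  proof -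
    have "r / 2 < Sup R" using that by (simp add: r_def)
    then obtain x where "x \<in> R" "r / 2 < x" using less_cSupD[OF R(1)] by blast
    then obtain u v where "u \<in> A" "v \<in> A" "r / 2 < d u v" by (auto simp: R_def)
    then show ?thesis by (intro bexI[of _ u] bexI[of _ v]) auto
  qed
  ultimately show ?thesis using le by blast
qed

section \<open>The main estimate\<close>

lemma Metric_space_dist_on: "Metric_space (E :: 'a::metric_space set) dist"
  using Metric_space.subspace[OF Met_TC.Metric_space_axioms] by simp

text \<open>Over the part of \<open>Y\<close> treated here, the images of the slices have \<open>\<tau>\<close>-content larger than one fixed
  \<open>c\<close>, so all \<open>y\<close> share the constants of the weighted cover. Quasisymmetry is only used in the form of the linear bound \<open>qs\<close>: the number 20
  arises as \<open>5 \<cdot> 4\<close>, with 5 from the Vitali enlargement and 4 because every point of a set with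
  diameter \<open>r\<close> has distance at least \<open>r/4\<close> from some other point of it.\<close>

lemma hausdorff_null_of_large_slices:
  fixes E :: "real set" and f :: "real \<times> 'b \<Rightarrow> 'c"
  assumes Y: "Metric_space Y dY" and Z: "Metric_space Z dZ" and fZ: "f ` (E \<times> Y) \<subseteq> Z"
    and E: "\<And>x. x \<in> E \<Longrightarrow> \<bar>x\<bar> \<le> L" and "0 \<le> L"
    and bdd: "\<And>u v. u \<in> E \<times> Y \<Longrightarrow> v \<in> E \<times> Y \<Longrightarrow> max_dist dist dY u v \<le> B" and "0 \<le> B"
    and qs: "\<And>u v w. u \<in> E \<times> Y \<Longrightarrow> v \<in> E \<times> Y \<Longrightarrow> w \<in> E \<times> Y \<Longrightarrow>
      max_dist dist dY u v \<le> 20 * max_dist dist dY v w \<Longrightarrow> dZ (f u) (f v) \<le> H * dZ (f v) (f w)"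
    and "0 < H"
    and null: "hausdorff_null p (f ` (E \<times> Y)) dZ"
    and exps: "0 < p" "0 < s" "0 < \<sigma>" "\<sigma> < \<tau>" "p \<le> \<tau> - \<sigma> + \<tau> * s" and "0 < c"
  shows "hausdorff_null s {y \<in> Y. \<not> has_cover ((\<lambda>x. f (x, y)) ` E) dZ \<tau> (ennreal c)} dY"
    (is "hausdorff_null s ?Y' dY")
proof (rule hausdorff_nullI)
  fix \<epsilon> :: real assume "0 < \<epsilon>"
  interpret Y: Metric_space Y dY by fact
  interpret Z: Metric_space Z dZ by fact
  interpret X: Metric_space "E \<times> Y" "max_dist dist dY"
    by (rule Metric_space_max_dist[OF Metric_space_dist_on Y])
  let ?d = "max_dist dist dY"
  have "0 < \<tau>" using exps by simp
  (* K bounds diameters of images of enlarged traces; \<kappa> separates the indices that are cheap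
     relative to their interval from the others; b is the constant of the dyadic pigeonhole for
     c / 2; Q collects all constants of the final estimate, and e makes both all a_i \<le> 1 and the
     final cost at most \<epsilon>. *)
  define K where "K = 2 * H"
  define \<kappa> where "\<kappa> = c / (2 * (L + B + 1))"
  define b where "b = c / 4 * (1 - 2 powr - \<sigma>)"
  define Q where "Q = 3 powr s / b * (2 powr (\<tau> - \<sigma>) * \<kappa> powr - s)"
  define e where "e = min (K powr - p) (\<epsilon> / (Q * K powr p))"
  have "0 < K" using \<open>0 < H\<close> by (simp add: K_def)
  have "0 < \<kappa>" using \<open>0 < c\<close> \<open>0 \<le> L\<close> \<open>0 \<le> B\<close> by (simp add: \<kappa>_def)
  have \<kappa>: "\<kappa> * (L + B) \<le> c / 2"
    using \<open>0 < c\<close> \<open>0 \<le> L\<close> \<open>0 \<le> B\<close> by (simp add: \<kappa>_def field_simps)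
  have "0 < b" using \<open>0 < c\<close> \<open>0 < \<sigma>\<close> powr_less_mono[of "- \<sigma>" 0 2] by (simp add: b_def)
  then have "0 < Q" using \<open>0 < \<kappa>\<close> by (simp add: Q_def)
  have "0 < e" using \<open>0 < K\<close> \<open>0 < Q\<close> \<open>0 < \<epsilon>\<close> by (simp add: e_def)
  have "K powr p * e \<le> K powr p * K powr - p"
    by (intro mult_left_mono) (auto simp: e_def)
  then have Ke1: "K powr p * e \<le> 1" using \<open>0 < K\<close> by (simp flip: powr_add)
  have "(Q * K powr p) * e \<le> (Q * K powr p) * (\<epsilon> / (Q * K powr p))"
    using \<open>0 < Q\<close> by (intro mult_left_mono) (auto simp: e_def)
  then have Ke2: "Q * (K powr p * e) \<le> \<epsilon>"
    using \<open>0 < Q\<close> \<open>0 < K\<close> by (simp add: mult.assoc)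

  obtain U \<rho> where U: "covers_with_diams (f ` (E \<times> Y)) dZ U \<rho>" and \<rho>: "\<And>i. 0 < \<rho> i"
    and sum_\<rho>: "(\<Sum>i. ennreal (\<rho> i powr p)) \<le> ennreal e"
    using hausdorff_null_coverE[OF null \<open>0 < p\<close> \<open>0 < e\<close>] by blast
  define a where "a i = K * \<rho> i" for i
  have a_pos: "0 < a i" for i using \<rho> \<open>0 < K\<close> by (simp add: a_def)
  have "(\<Sum>i. ennreal (a i powr p)) = (\<Sum>i. ennreal (K powr p) * ennreal (\<rho> i powr p))"
    using \<rho> \<open>0 < K\<close> by (intro suminf_cong) (simp add: a_def powr_mult less_imp_le flip: ennreal_mult)
  also have "\<dots> = ennreal (K powr p) * (\<Sum>i. ennreal (\<rho> i powr p))"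
    by (rule ennreal_suminf_cmult)
  also have "\<dots> \<le> ennreal (K powr p) * ennreal e"
    by (rule mult_left_mono[OF sum_\<rho>]) simp
  also have "\<dots> = ennreal (K powr p * e)"
    using \<open>0 < e\<close> by (simp add: ennreal_mult)
  finally have sum_a: "(\<Sum>i. ennreal (a i powr p)) \<le> ennreal (K powr p * e)" .
  have a_le1: "a i \<le> 1" for i
    by (rule suminf_powr_le_1D[OF sum_a]) (use \<open>0 < e\<close> Ke1 \<open>0 < p\<close> in auto)

  define A where "A i = {u \<in> E \<times> Y. f u \<in> U i}" for i
  have "\<exists>r. 0 \<le> r \<and> r \<le> B \<and> (\<forall>u\<in>A i. \<forall>v\<in>A i. ?d u v \<le> r) \<and>
      (0 < r \<longrightarrow> (\<exists>u\<in>A i. \<exists>v\<in>A i. r \<le> 2 * ?d u v))" for i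
    by (rule exists_half_attained_diameter) (use bdd X.nonneg \<open>0 \<le> B\<close> in \<open>auto simp: A_def\<close>)
  then obtain r where r: "\<And>i. 0 \<le> r i" "\<And>i. r i \<le> B"
    and diam_A: "\<And>i u v. u \<in> A i \<Longrightarrow> v \<in> A i \<Longrightarrow> ?d u v \<le> r i"
    and attained: "\<And>i. 0 < r i \<Longrightarrow> \<exists>u\<in>A i. \<exists>v\<in>A i. r i \<le> 2 * ?d u v"
    by metis
  define D where "D i = snd ` A i" for i
  have DY: "D i \<subseteq> Y" for i by (auto simp: D_def A_def)
  have diam_D: "dY y z \<le> r i" if yz: "y \<in> D i" "z \<in> D i" for i y z
  proof -
    obtain x x' where "(x, y) \<in> A i" "(x', z) \<in> A i" using yz by (auto simp: D_def)
    from diam_A[OF this] show ?thesis by (simp add: max_dist_def)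
  qed

  (* A point near A_i on the same slice has its image near f(A_i): compare with a point w of A_i
     far from (x, y), whose image has distance at most \<rho>_i from that of (x, y). If A_i is a
     single point, the enlarged interval is degenerate as well. *)
  have near: "dZ (f (x', y)) (f (x, y)) \<le> H * \<rho> i"
    if xy: "(x, y) \<in> A i" and x': "x' \<in> E" "\<bar>x' - x\<bar> \<le> 5 * r i" for i x x' y
  proof (cases "r i = 0")
    case True
    then have "x' = x" using x' by simp
    moreover have "f (x, y) \<in> Z" using xy fZ by (auto simp: A_def)
    ultimately show ?thesis using \<rho>[of i] \<open>0 < H\<close> by simp
  next
    case False
    then have "0 < r i" using r(1)[of i] by simp
    then obtain u v where uv: "u \<in> A i" "v \<in> A i" "r i \<le> 2 * ?d u v" using attained by blast
    have mem: "u \<in> E \<times> Y" "v \<in> E \<times> Y" "(x, y) \<in> E \<times> Y" "(x', y) \<in> E \<times> Y"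
      using uv xy x' by (auto simp: A_def)
    have "?d u v \<le> ?d (x, y) u + ?d (x, y) v"
      using X.triangle[OF mem(1,3,2)] X.commute[of u "(x, y)"] by simp
    then have "r i \<le> 4 * ?d (x, y) u \<or> r i \<le> 4 * ?d (x, y) v" using uv by linarith
    then obtain w where w: "w \<in> A i" "r i \<le> 4 * ?d (x, y) w" using uv by blast
    have "?d (x', y) (x, y) = \<bar>x' - x\<bar>"
      using mem by (simp add: max_dist_def dist_real_def)
    then have "?d (x', y) (x, y) \<le> 20 * ?d (x, y) w" using w x' by linarith
    then have "dZ (f (x', y)) (f (x, y)) \<le> H * dZ (f (x, y)) (f w)"
      using mem w by (intro qs) (auto simp: A_def)
    also have "\<dots> \<le> H * \<rho> i"
      using covers_with_diamsD(3)[OF U, of "f (x, y)" i "f w"] w xy \<open>0 < H\<close>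
      by (intro mult_left_mono) (auto simp: A_def)
    finally show ?thesis .
  qed

  define G where "G y = {i. y \<in> D i \<and> \<kappa> * r i < a i powr \<tau>}" for y
  have slice: "ennreal (c / 2) \<le> (\<Sum>i. ennreal (a i powr \<tau>) * indicator (G y) i)"
    if y: "y \<in> ?Y'" for y
  proof -
    define J where "J = {i. y \<in> D i}"
    have "\<forall>i\<in>J. \<exists>x. (x, y) \<in> A i" by (auto simp: J_def D_def)
    then obtain x where x: "\<And>i. i \<in> J \<Longrightarrow> (x i, y) \<in> A i" by metis
    have cover: "E \<subseteq> (\<Union>i\<in>J. cball (x i) (r i))"
    proof
      fix z assume "z \<in> E"
      then have "(z, y) \<in> E \<times> Y" using y by simp
      then obtain i where "f (z, y) \<in> U i" using covers_with_diamsD(1)[OF U] by blast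
      then have zA: "(z, y) \<in> A i" using \<open>(z, y) \<in> E \<times> Y\<close> by (simp add: A_def)
      then have "i \<in> J" by (force simp: J_def D_def)
      moreover from this have "dist (x i) z \<le> r i"
        using diam_A[OF x zA] by (simp add: max_dist_def)
      ultimately show "z \<in> (\<Union>i\<in>J. cball (x i) (r i))" by auto
    qed
    have x_le: "\<bar>x i\<bar> \<le> L" if "i \<in> J" for i
      using x[OF that] E by (auto simp: A_def)
    obtain J' where J': "J' \<subseteq> J" "E \<subseteq> (\<Union>i\<in>J'. cball (x i) (5 * r i))"
      and len: "(\<Sum>i. ennreal (r i) * indicator J' i) \<le> ennreal (L + B)"
      by (rule interval_subcover[OF cover x_le r(1) r(2) \<open>0 \<le> L\<close> \<open>0 \<le> B\<close>])
    let ?f = "\<lambda>x. f (x, y)"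
    have "has_cover (?f ` E) dZ \<tau> (\<Sum>i. ennreal (a i powr \<tau>) * indicator J' i)"
    proof (rule has_cover_onI[where J = J' and U = "\<lambda>i. ?f ` (E \<inter> cball (x i) (5 * r i))" and r = a])
      show "?f ` E \<subseteq> (\<Union>i\<in>J'. ?f ` (E \<inter> cball (x i) (5 * r i)))" using J'(2) by blast
      show "0 \<le> a i" for i using a_pos[of i] by simp
      show "dZ u v \<le> a i" if i: "i \<in> J'" and uv: "u \<in> ?f ` (E \<inter> cball (x i) (5 * r i))"
        "v \<in> ?f ` (E \<inter> cball (x i) (5 * r i))" for i u v
      proof -
        have xi: "(x i, y) \<in> A i" using i J'(1) x by blast
        have close: "w \<in> Z \<and> dZ w (?f (x i)) \<le> H * \<rho> i" if "w \<in> ?f ` (E \<inter> cball (x i) (5 * r i))" for w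
          using that near[OF xi] fZ y by (auto simp: dist_real_def abs_minus_commute)
        have "?f (x i) \<in> Z" using xi fZ by (auto simp: A_def)
        then have "dZ u v \<le> dZ u (?f (x i)) + dZ v (?f (x i))"
          using close[OF uv(1)] close[OF uv(2)] Z.triangle[of u "?f (x i)" v] Z.commute[of v] by simp
        also have "\<dots> \<le> a i" using close[OF uv(1)] close[OF uv(2)] by (simp add: a_def K_def)
        finally show ?thesis .
      qed
    qed simp
    (* The subfamily J' gives a cover of the image of the slice, so its cost exceeds c. Its members
       outside G y cost at most \<kappa> times their total length. *)
    then have "\<not> (\<Sum>i. ennreal (a i powr \<tau>) * indicator J' i) \<le> ennreal c"
      using y has_cover_mono by blast
    then have "ennreal c < (\<Sum>i. ennreal (a i powr \<tau>) * indicator J' i)" by simp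
    also have "\<dots> \<le> (\<Sum>i. ennreal (a i powr \<tau>) * indicator (G y) i +
        ennreal \<kappa> * (ennreal (r i) * indicator J' i))"
    proof (intro suminf_le)
      fix i
      show "ennreal (a i powr \<tau>) * indicator J' i \<le> ennreal (a i powr \<tau>) * indicator (G y) i +
        ennreal \<kappa> * (ennreal (r i) * indicator J' i)"
      proof (cases "i \<in> J' \<and> i \<notin> G y")
        case True
        then have "a i powr \<tau> \<le> \<kappa> * r i" using J'(1) by (auto simp: G_def J_def)
        then show ?thesis
          using True \<open>0 < \<kappa>\<close> r(1)[of i] by (simp add: ennreal_leI flip: ennreal_mult)
      qed (auto simp: indicator_def)
    qed auto
    also have "\<dots> = (\<Sum>i. ennreal (a i powr \<tau>) * indicator (G y) i) +
        (\<Sum>i. ennreal \<kappa> * (ennreal (r i) * indicator J' i))"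
      by (rule suminf_add[symmetric]) auto
    also have "\<dots> = (\<Sum>i. ennreal (a i powr \<tau>) * indicator (G y) i) +
        ennreal \<kappa> * (\<Sum>i. ennreal (r i) * indicator J' i)"
      by (simp only: ennreal_suminf_cmult)
    also have "\<dots> \<le> (\<Sum>i. ennreal (a i powr \<tau>) * indicator (G y) i) + ennreal (c / 2)"
    proof (rule add_left_mono)
      have "ennreal \<kappa> * (\<Sum>i. ennreal (r i) * indicator J' i) \<le> ennreal \<kappa> * ennreal (L + B)"
        by (rule mult_left_mono[OF len]) simp
      also have "\<dots> = ennreal (\<kappa> * (L + B))"
        using \<open>0 < \<kappa>\<close> \<open>0 \<le> L\<close> \<open>0 \<le> B\<close> by (intro ennreal_mult[symmetric]) auto
      also have "\<dots> \<le> ennreal (c / 2)" by (rule ennreal_leI[OF \<kappa>])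
      finally show "ennreal \<kappa> * (\<Sum>i. ennreal (r i) * indicator J' i) \<le> ennreal (c / 2)" .
    qed
    finally have lt: "ennreal c < (\<Sum>i. ennreal (a i powr \<tau>) * indicator (G y) i) + ennreal (c / 2)" .
    show ?thesis
    proof (rule ccontr)
      assume "\<not> ?thesis"
      then have "(\<Sum>i. ennreal (a i powr \<tau>) * indicator (G y) i) + ennreal (c / 2) \<le>
          ennreal (c / 2) + ennreal (c / 2)"
        by (intro add_right_mono) simp
      also have "\<dots> = ennreal c" using \<open>0 < c\<close> by (subst ennreal_plus[symmetric]) auto
      finally show False using lt by simp
    qed
  qed

  (* The dyadic pigeonhole, applied to the weights of the slice over y, puts y into some W k. *)
  define F where "F k = {i. \<kappa> * r i < a i powr \<tau> \<and> dyadic_level (a i) = k}" for k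
  have finite_a: "finite {i. \<beta> \<le> a i}" if "0 < \<beta>" for \<beta>
    by (rule finite_ge_of_suminf_powr[OF sum_a \<open>0 < p\<close> that])
  have finF: "finite (F k)" for k
  proof (rule finite_subset)
    show "F k \<subseteq> {i. 2 powr - (real k + 1) \<le> a i}"
      using dyadic_level_bounds(2)[OF a_pos a_le1] by (auto simp: F_def)
  qed (simp add: finite_a)
  define W where "W k = {y. b * 2 powr ((\<tau> - \<sigma>) * real k) \<le> real (card {i \<in> F k. y \<in> D i})}" for k
  have "?Y' \<subseteq> (\<Union>k. W k)"
  proof
    fix y assume "y \<in> ?Y'"
    obtain k where "c / 2 / 2 * (1 - 2 powr - \<sigma>) * 2 powr ((\<tau> - \<sigma>) * real k) \<le>
        real (card {i \<in> G y. dyadic_level (a i) = k})"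
      using exists_populous_dyadic_level[OF a_pos a_le1 finite_a \<open>0 < \<sigma>\<close> \<open>0 < \<tau>\<close> _ slice[OF \<open>y \<in> ?Y'\<close>]]
        \<open>0 < c\<close> by auto
    moreover have "{i \<in> G y. dyadic_level (a i) = k} = {i \<in> F k. y \<in> D i}"
      by (auto simp: G_def F_def)
    ultimately have "y \<in> W k" by (simp add: W_def b_def)
    then show "y \<in> (\<Union>k. W k)" by blast
  qed
  moreover have "has_cover (W k) dY s (\<Sum>i. ennreal Q * (ennreal (a i powr p) * indicator (F k) i))" for k
  proof -
    let ?b = "b * 2 powr ((\<tau> - \<sigma>) * real k)"
    have "has_cover (W k) dY s (ennreal (3 powr s / ?b * (\<Sum>i\<in>F k. r i powr s)))"
      unfolding W_def by (rule Y.has_cover_multiple_points[OF finF DY r(1) diam_D]) (use \<open>0 < b\<close> in auto)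
    moreover have "3 powr s / ?b * (\<Sum>i\<in>F k. r i powr s) \<le> (\<Sum>i\<in>F k. Q * a i powr p)"
      unfolding sum_distrib_left
    proof (rule sum_mono)
      fix i assume i: "i \<in> F k"
      have "r i \<le> a i powr \<tau> / \<kappa>"
        using i \<open>0 < \<kappa>\<close> by (simp add: F_def field_simps)
      then have "r i powr s \<le> (a i powr \<tau> / \<kappa>) powr s"
        using r(1)[of i] \<open>0 < s\<close> by (intro powr_mono2) auto
      also have "\<dots> = \<kappa> powr - s * a i powr (\<tau> * s)"
        using \<open>0 < \<kappa>\<close> a_pos[of i] by (simp add: powr_divide powr_powr powr_minus_divide)
      finally have 1: "r i powr s \<le> \<kappa> powr - s * a i powr (\<tau> * s)" .
      have "2 powr - (real k + 1) \<le> a i"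
        using dyadic_level_bounds(2)[OF a_pos a_le1, of i] i by (simp add: F_def)
      then have "(2 powr - (real k + 1)) powr (\<tau> - \<sigma>) \<le> a i powr (\<tau> - \<sigma>)"
        using exps by (intro powr_mono2) auto
      then have "2 powr (\<tau> - \<sigma>) * (2 powr - (real k + 1)) powr (\<tau> - \<sigma>) \<le>
          2 powr (\<tau> - \<sigma>) * a i powr (\<tau> - \<sigma>)"
        by (rule mult_left_mono) simp
      moreover have "2 powr (\<tau> - \<sigma>) * (2 powr - (real k + 1)) powr (\<tau> - \<sigma>) =
          2 powr - ((\<tau> - \<sigma>) * real k)"
        by (simp add: powr_powr algebra_simps flip: powr_add)
      ultimately have 2: "1 / 2 powr ((\<tau> - \<sigma>) * real k) \<le> 2 powr (\<tau> - \<sigma>) * a i powr (\<tau> - \<sigma>)"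
        by (simp only: powr_minus_divide)
      have "3 powr s / ?b * r i powr s = 3 powr s / b * (1 / 2 powr ((\<tau> - \<sigma>) * real k) * r i powr s)"
        by simp
      also have "\<dots> \<le> 3 powr s / b *
          ((2 powr (\<tau> - \<sigma>) * a i powr (\<tau> - \<sigma>)) * (\<kappa> powr - s * a i powr (\<tau> * s)))"
        using \<open>0 < b\<close> by (intro mult_left_mono mult_mono 1 2) auto
      also have "\<dots> = Q * a i powr (\<tau> - \<sigma> + \<tau> * s)"
        by (simp add: Q_def powr_add mult.assoc mult.left_commute)
      also have "\<dots> \<le> Q * a i powr p"
        using a_pos[of i] a_le1[of i] exps \<open>0 < Q\<close> by (intro mult_left_mono powr_mono') auto
      finally show "3 powr s / ?b * r i powr s \<le> Q * a i powr p" .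
    qed
    moreover have "ennreal (\<Sum>i\<in>F k. Q * a i powr p) =
        (\<Sum>i. ennreal (Q * a i powr p) * indicator (F k) i)"
      using \<open>0 < Q\<close> by (simp add: suminf_indicator_finite[OF finF])
    moreover have "\<dots> = (\<Sum>i. ennreal Q * (ennreal (a i powr p) * indicator (F k) i))"
      using \<open>0 < Q\<close> by (simp add: ennreal_mult mult.assoc)
    ultimately show ?thesis
      by (metis has_cover_mono ennreal_leI order_refl)
  qed
  then have "has_cover (\<Union>k. W k) dY s
      (\<Sum>k. \<Sum>i. ennreal Q * (ennreal (a i powr p) * indicator (F k) i))"
    by (rule has_cover_UN)
  moreover have "(\<Sum>k. \<Sum>i. ennreal Q * (ennreal (a i powr p) * indicator (F k) i)) \<le> ennreal \<epsilon>"
  proof -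
    have "disjoint_family F" by (auto simp: disjoint_family_on_def F_def)
    have "(\<Sum>k. \<Sum>i. ennreal Q * (ennreal (a i powr p) * indicator (F k) i)) =
        ennreal Q * (\<Sum>k. \<Sum>i. ennreal (a i powr p) * indicator (F k) i)"
      by (simp only: ennreal_suminf_cmult)
    also have "\<dots> = ennreal Q * (\<Sum>i. ennreal (a i powr p) * indicator (\<Union>k. F k) i)"
      by (simp only: suminf_indicator_UN[OF \<open>disjoint_family F\<close>])
    also have "\<dots> \<le> ennreal Q * (\<Sum>i. ennreal (a i powr p))"
      by (intro mult_left_mono suminf_le) (auto simp: indicator_def)
    also have "\<dots> \<le> ennreal Q * ennreal (K powr p * e)"
      by (rule mult_left_mono[OF sum_a]) simp
    also have "\<dots> = ennreal (Q * (K powr p * e))"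
      using \<open>0 < Q\<close> \<open>0 < e\<close> by (intro ennreal_mult[symmetric]) auto
    also have "\<dots> \<le> ennreal \<epsilon>" by (rule ennreal_leI[OF Ke2])
    finally show ?thesis .
  qed
  ultimately show "has_cover ?Y' dY s (ennreal \<epsilon>)"
    using has_cover_mono by blast
qed

section \<open>Quasisymmetric maps on the product and on its slices\<close>

lemma embedding_map_metric_spaceD:
  assumes X: "Metric_space X dX" and Z: "Metric_space Z dZ"
    and emb: "embedding_map (Metric_space.mtopology X dX) (Metric_space.mtopology Z dZ) f"
  shows "f ` X \<subseteq> Z" "inj_on f X"
proof -
  interpret X: Metric_space X dX by fact
  interpret Z: Metric_space Z dZ by fact
  note hom = emb[unfolded embedding_map_def]
  show "inj_on f X"
    using homeomorphic_imp_injective_map[OF hom] by (simp only: X.topspace_mtopology)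
  have "f ` X = Z \<inter> f ` X"
    using homeomorphic_imp_surjective_map[OF hom]
    by (simp only: topspace_subtopology X.topspace_mtopology Z.topspace_mtopology)
  then show "f ` X \<subseteq> Z" by blast
qed

text \<open>The quasisymmetry condition speaks of distinct points and of quotients. With \<open>H \<ge> 1\<close> the
  product form also covers coinciding points.\<close>

lemma quasisymmetric_imp_linear_bound:
  assumes X: "Metric_space X dX" and Z: "Metric_space Z dZ" and f: "quasisymmetric X dX Z dZ f"
    and "0 < t"
  obtains H where "0 < H" "\<And>u v w. u \<in> X \<Longrightarrow> v \<in> X \<Longrightarrow> w \<in> X \<Longrightarrow> dX u v \<le> t * dX v w \<Longrightarrow>
    dZ (f u) (f v) \<le> H * dZ (f v) (f w)"
proof -
  interpret X: Metric_space X dX by fact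
  interpret Z: Metric_space Z dZ by fact
  obtain \<eta> where emb: "embedding_map X.mtopology Z.mtopology f"
    and qs: "\<And>u v w. u \<in> X \<Longrightarrow> v \<in> X \<Longrightarrow> w \<in> X \<Longrightarrow> u \<noteq> v \<Longrightarrow> v \<noteq> w \<Longrightarrow> u \<noteq> w \<Longrightarrow>
      dX u v / dX v w \<le> t \<Longrightarrow> dZ (f u) (f v) / dZ (f v) (f w) \<le> \<eta> t"
    using f \<open>0 < t\<close> unfolding quasisymmetric_def eta_quasisymmetric_def by metis
  have fZ: "f x \<in> Z" if "x \<in> X" for x
    using embedding_map_metric_spaceD(1)[OF X Z emb] that by blast
  define H where "H = max 1 (\<eta> t)"
  have "dZ (f u) (f v) \<le> H * dZ (f v) (f w)"
    if mem: "u \<in> X" "v \<in> X" "w \<in> X" and le: "dX u v \<le> t * dX v w" for u v w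
  proof -
    have nn: "0 \<le> H * dZ (f v) (f w)" by (simp add: H_def)
    consider "u = v" | "u \<noteq> v" "v = w" | "u \<noteq> v" "u = w" | "u \<noteq> v" "v \<noteq> w" "u \<noteq> w" by blast
    then show ?thesis
    proof cases
      case 1
      then show ?thesis using nn fZ mem by simp
    next
      case 2
      then have "dX v w = 0" using mem by simp
      then have "dX u v = 0" using le X.nonneg[of u v] by (intro antisym) auto
      then show ?thesis using 2 mem by simp
    next
      case 3
      have "1 * dZ (f v) (f w) \<le> H * dZ (f v) (f w)" by (intro mult_right_mono) (auto simp: H_def)
      then show ?thesis using 3 Z.commute by simp
    next
      case 4
      have "f v \<noteq> f w" using embedding_map_metric_spaceD(2)[OF X Z emb] mem 4 by (auto dest: inj_onD)
      then have pos: "0 < dX v w" "0 < dZ (f v) (f w)"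
        using X.mdist_pos_less Z.mdist_pos_less mem fZ 4 by auto
      then have "dX u v / dX v w \<le> t" using le by (simp add: pos_divide_le_eq)
      then have "dZ (f u) (f v) / dZ (f v) (f w) \<le> H" using qs[of u v w] mem 4 by (simp add: H_def)
      then show ?thesis using pos by (simp add: pos_divide_le_eq)
    qed
  qed
  then show ?thesis by (intro that[of H]) (auto simp: H_def)
qed

lemma quasisymmetric_slice:
  assumes X: "Metric_space X dX" and Y: "Metric_space Y dY" and Z: "Metric_space Z dZ"
    and f: "quasisymmetric (X \<times> Y) (max_dist dX dY) Z dZ f" and "y \<in> Y"
  shows "quasisymmetric X dX Z dZ (\<lambda>x. f (x, y))"
proof -
  interpret X: Metric_space X dX by fact
  interpret Y: Metric_space Y dY by fact
  interpret Z: Metric_space Z dZ by fact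
  interpret XY: Metric_space "X \<times> Y" "max_dist dX dY" by (rule Metric_space_max_dist[OF X Y])
  interpret iso: Metric_space12 X dX "X \<times> Y" "max_dist dX dY" by unfold_locales
  have dist: "max_dist dX dY (u, y) (v, y) = dX u v" for u v
    using \<open>y \<in> Y\<close> by (simp add: max_dist_def)
  have incl: "embedding_map X.mtopology XY.mtopology (\<lambda>x. (x, y))"
    by (rule iso.isometry_imp_embedding_map) (use \<open>y \<in> Y\<close> in \<open>auto simp: dist\<close>)
  obtain \<eta> where \<eta>: "homeomorphic_map (top_of_set {0..}) (top_of_set {0..}) \<eta>"
    and q: "eta_quasisymmetric \<eta> (X \<times> Y) (max_dist dX dY) Z dZ f"
    using f by (auto simp: quasisymmetric_def)
  have "embedding_map X.mtopology Z.mtopology (f \<circ> (\<lambda>x. (x, y)))"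
    using q unfolding eta_quasisymmetric_def by (intro embedding_map_compose[OF incl]) blast
  moreover have "dZ (f (u, y)) (f (v, y)) / dZ (f (v, y)) (f (w, y)) \<le> \<eta> t"
    if "u \<in> X" "v \<in> X" "w \<in> X" "u \<noteq> v" "v \<noteq> w" "u \<noteq> w" "0 < t" "dX u v / dX v w \<le> t" for u v w t
    using q \<open>y \<in> Y\<close> that unfolding eta_quasisymmetric_def
    by (auto simp: dist dest!: conjunct2 bspec[of _ _ "(u, y)"] bspec[of _ _ "(v, y)"] bspec[of _ _ "(w, y)"])
  ultimately have "eta_quasisymmetric \<eta> X dX Z dZ (\<lambda>x. f (x, y))"
    unfolding eta_quasisymmetric_def comp_def by blast
  with \<eta> show ?thesis unfolding quasisymmetric_def by blast
qed

lemma conformal_dim_le_hausdorff_dim: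
  assumes "Metric_space X d"
  shows "conformal_dim X d \<le> hausdorff_dim X d"
proof -
  have emb: "embedding_map T T id" for T :: "'a topology"
    by (simp add: embedding_map_def)
  have "quasisymmetric X d X d id"
    unfolding quasisymmetric_def eta_quasisymmetric_def
    by (intro exI[of _ id] conjI emb) auto
  then show ?thesis using conformal_dim_le[OF assms assms] by fastforce
qed

lemma ennreal_le_of_real_bounds:
  fixes a b :: ennreal
  assumes "\<And>p. 0 < p \<Longrightarrow> b < ennreal p \<Longrightarrow> a \<le> ennreal p"
  shows "a \<le> b"
proof (rule dense_ge)
  fix x assume "b < x"
  then show "a \<le> x"
  proof (cases x)
    case (real p)
    then have "0 < ennreal p" using \<open>b < x\<close> by (metis gr_zeroI not_less_zero)
    then show ?thesis using real \<open>b < x\<close> assms[of p] by (simp add: ennreal_less_zero_iff)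
  qed auto
qed

lemma hausdorff_dim_times_le:
  fixes E :: "real set"
  shows "hausdorff_dim (E \<times> Y) (max_dist dist dY) \<le> 1 + hausdorff_dim Y dY"
proof (rule ennreal_le_of_real_bounds)
  fix p :: real assume "1 + hausdorff_dim Y dY < ennreal p"
  then have *: "hausdorff_dim Y dY < ennreal (p - 1)" "0 < p - 1"
    by (cases "hausdorff_dim Y dY"; auto simp: ennreal_less_iff simp flip: ennreal_plus ennreal_1)+
  then have "hausdorff_null (1 + (p - 1)) (E \<times> Y) (max_dist dist dY)"
    by (intro hausdorff_null_times hausdorff_null_of_hausdorff_dim_less)
  then show "hausdorff_dim (E \<times> Y) (max_dist dist dY) \<le> ennreal p"
    using * by (intro hausdorff_dim_le_of_hausdorff_null) auto
qed

text \<open>With \<open>\<tau> = 1 - \<sigma>\<close> the condition \<open>p \<le> \<tau> - \<sigma> + \<tau> s\<close> reads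
  \<open>\<sigma> (2 + s) \<le> 1 + s - p\<close>, and \<open>\<sigma> \<le> 1/3\<close> ensures \<open>\<sigma> < \<tau>\<close>. The uniform data of the main estimate come
  from countable exhaustion: some bounded piece of each slice already has an image of positive
  \<open>\<tau>\<close>-content, which exceeds \<open>1/(n + 1)\<close> for some \<open>n\<close>.\<close>

lemma hausdorff_null_factor:
  fixes E :: "real set" and f :: "real \<times> 'b \<Rightarrow> 'c"
  assumes Y: "Metric_space Y dY" and Z: "Metric_space Z dZ"
    and f: "quasisymmetric (E \<times> Y) (max_dist dist dY) Z dZ f"
    and bdd: "\<And>y z. y \<in> Y \<Longrightarrow> z \<in> Y \<Longrightarrow> dY y z \<le> B"
    and slices: "\<And>y \<tau>. y \<in> Y \<Longrightarrow> 0 < \<tau> \<Longrightarrow> \<tau> < 1 \<Longrightarrow> \<not> hausdorff_null \<tau> ((\<lambda>x. f (x, y)) ` E) dZ"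
    and null: "hausdorff_null p (f ` (E \<times> Y)) dZ" and "0 < p" "0 < s" "p < 1 + s"
  shows "hausdorff_null s Y dY"
proof -
  interpret Y: Metric_space Y dY by fact
  have E: "Metric_space E dist"
    by (rule Metric_space_dist_on)
  have X: "Metric_space (E \<times> Y) (max_dist dist dY)" by (rule Metric_space_max_dist[OF E Y])
  obtain H where "0 < H" and H: "\<And>u v w. u \<in> E \<times> Y \<Longrightarrow> v \<in> E \<times> Y \<Longrightarrow> w \<in> E \<times> Y \<Longrightarrow>
      max_dist dist dY u v \<le> 20 * max_dist dist dY v w \<Longrightarrow> dZ (f u) (f v) \<le> H * dZ (f v) (f w)"
    by (rule quasisymmetric_imp_linear_bound[OF X Z f, of 20]) auto
  have fZ: "f ` (E \<times> Y) \<subseteq> Z"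
    using f embedding_map_metric_spaceD(1)[OF X Z] unfolding quasisymmetric_def eta_quasisymmetric_def by blast
  define \<sigma> where "\<sigma> = min (1/3) ((1 + s - p) / (2 + s))"
  define \<tau> where "\<tau> = 1 - \<sigma>"
  have "0 < \<sigma>" using \<open>0 < s\<close> \<open>p < 1 + s\<close> by (simp add: \<sigma>_def)
  moreover have "\<sigma> \<le> 1/3" unfolding \<sigma>_def by (rule min.cobounded1)
  ultimately have \<sigma>: "0 < \<sigma>" "\<sigma> \<le> 1/3" .
  have \<tau>: "0 < \<tau>" "\<tau> < 1" "\<sigma> < \<tau>" using \<sigma> by (auto simp: \<tau>_def)
  have "\<sigma> * (2 + s) \<le> (1 + s - p) / (2 + s) * (2 + s)"
    using \<open>0 < s\<close> by (intro mult_right_mono) (auto simp: \<sigma>_def)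
  then have "\<sigma> * (2 + s) \<le> 1 + s - p" using \<open>0 < s\<close> by simp
  then have exponents: "p \<le> \<tau> - \<sigma> + \<tau> * s" by (simp add: \<tau>_def algebra_simps)
  define T where "T N = E \<inter> {-real N..real N}" for N :: nat
  define Y' where "Y' N n = {y \<in> Y. \<not> has_cover ((\<lambda>x. f (x, y)) ` T N) dZ \<tau> (ennreal (1 / real (Suc n)))}"
    for N n
  have null_Y': "hausdorff_null s (Y' N n) dY" for N n
    unfolding Y'_def
  proof (rule hausdorff_null_of_large_slices[where E = "T N" and H = H and p = p and \<sigma> = \<sigma>])
    have sub: "T N \<times> Y \<subseteq> E \<times> Y" by (auto simp: T_def)
    show "f ` (T N \<times> Y) \<subseteq> Z" using image_mono[OF sub] fZ by (rule subset_trans)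
    show "hausdorff_null p (f ` (T N \<times> Y)) dZ" by (rule hausdorff_null_mono[OF null image_mono[OF sub]])
    show "\<bar>x\<bar> \<le> real N" if "x \<in> T N" for x using that by (auto simp: T_def)
    show "max_dist dist dY u v \<le> max 0 (max (2 * real N) B)" if "u \<in> T N \<times> Y" "v \<in> T N \<times> Y" for u v
    proof -
      obtain x y x' y' where uv: "u = (x, y)" "v = (x', y')" by (metis surj_pair)
      then have "\<bar>x - x'\<bar> \<le> 2 * real N" "dY y y' \<le> B" using that bdd by (auto simp: T_def)
      then show ?thesis using uv by (auto simp: max_dist_def dist_real_def)
    qed
    show "dZ (f u) (f v) \<le> H * dZ (f v) (f w)"
      if "u \<in> T N \<times> Y" "v \<in> T N \<times> Y" "w \<in> T N \<times> Y"
        "max_dist dist dY u v \<le> 20 * max_dist dist dY v w" for u v w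
      using that sub by (intro H) auto
  qed (use Y Z \<open>0 < H\<close> \<open>0 < p\<close> \<open>0 < s\<close> \<sigma> \<tau> exponents in auto)
  have "Y \<subseteq> (\<Union>N. \<Union>n. Y' N n)"
  proof (rule subsetI, rule ccontr)
    fix y assume "y \<in> Y" "y \<notin> (\<Union>N. \<Union>n. Y' N n)"
    then have y: "y \<in> Y" "y \<notin> Y' N n" for N n by simp_all
    have "hausdorff_null \<tau> ((\<lambda>x. f (x, y)) ` T N) dZ" for N
    proof (rule hausdorff_nullI)
      fix \<epsilon> :: real assume "0 < \<epsilon>"
      then obtain n where "1 / real (Suc n) < \<epsilon>"
        using reals_Archimedean[of \<epsilon>] by (auto simp: inverse_eq_divide)
      moreover have "has_cover ((\<lambda>x. f (x, y)) ` T N) dZ \<tau> (ennreal (1 / real (Suc n)))"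
        using y by (auto simp: Y'_def)
      ultimately show "has_cover ((\<lambda>x. f (x, y)) ` T N) dZ \<tau> (ennreal \<epsilon>)"
        by (elim has_cover_mono) (auto intro: ennreal_leI)
    qed
    then have "hausdorff_null \<tau> (\<Union>N. (\<lambda>x. f (x, y)) ` T N) dZ" by (rule hausdorff_null_UN)
    moreover have "(\<lambda>x. f (x, y)) ` E \<subseteq> (\<Union>N. (\<lambda>x. f (x, y)) ` T N)"
    proof clarsimp
      fix x assume "x \<in> E"
      obtain N :: nat where "\<bar>x\<bar> \<le> real N" using real_arch_simple by blast
      with \<open>x \<in> E\<close> have "x \<in> T N" by (auto simp: T_def)
      then show "\<exists>N. f (x, y) \<in> (\<lambda>x. f (x, y)) ` T N" by blast
    qed
    ultimately have "hausdorff_null \<tau> ((\<lambda>x. f (x, y)) ` E) dZ" by (rule hausdorff_null_mono)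
    then show False using slices y(1) \<tau> by blast
  qed
  moreover have "hausdorff_null s (\<Union>N. \<Union>n. Y' N n) dY"
    by (intro hausdorff_null_UN null_Y')
  ultimately show ?thesis by (rule hausdorff_null_mono[rotated])
qed

lemma hausdorff_dim_quasisymmetric_image_times_ge:
  fixes E :: "real set" and f :: "real \<times> 'b \<Rightarrow> 'c"
  assumes Y: "Metric_space Y dY" and Z: "Metric_space Z dZ"
    and f: "quasisymmetric (E \<times> Y) (max_dist dist dY) Z dZ f"
    and bdd: "\<And>y z. y \<in> Y \<Longrightarrow> z \<in> Y \<Longrightarrow> dY y z \<le> B" and "Y \<noteq> {}"
    and E: "1 \<le> conformal_dim E dist"
  shows "1 + hausdorff_dim Y dY \<le> hausdorff_dim (f ` (E \<times> Y)) dZ"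
proof (rule ennreal_le_of_real_bounds)
  fix p :: real assume "0 < p" and p: "hausdorff_dim (f ` (E \<times> Y)) dZ < ennreal p"
  have metric_E: "Metric_space E dist"
    by (rule Metric_space_dist_on)
  have slices: "\<not> hausdorff_null \<tau> ((\<lambda>x. f (x, y)) ` E) dZ" if "y \<in> Y" "0 < \<tau>" "\<tau> < 1" for y \<tau>
  proof
    assume "hausdorff_null \<tau> ((\<lambda>x. f (x, y)) ` E) dZ"
    then have "hausdorff_dim ((\<lambda>x. f (x, y)) ` E) dZ \<le> ennreal \<tau>"
      using \<open>0 < \<tau>\<close> by (rule hausdorff_dim_le_of_hausdorff_null)
    moreover have "1 \<le> hausdorff_dim ((\<lambda>x. f (x, y)) ` E) dZ"
      using E conformal_dim_le[OF metric_E Z quasisymmetric_slice[OF metric_E Y Z f \<open>y \<in> Y\<close>]]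
      by (rule order_trans)
    ultimately have "1 \<le> ennreal \<tau>" by (rule order_trans[rotated])
    with \<open>\<tau> < 1\<close> show False by simp
  qed
  have null: "hausdorff_null p (f ` (E \<times> Y)) dZ" by (rule hausdorff_null_of_hausdorff_dim_less[OF p])
  have "1 \<le> p"
  proof (rule ccontr)
    assume "\<not> 1 \<le> p"
    obtain y where "y \<in> Y" using \<open>Y \<noteq> {}\<close> by blast
    then have "(\<lambda>x. f (x, y)) ` E \<subseteq> f ` (E \<times> Y)" by auto
    then have "hausdorff_null p ((\<lambda>x. f (x, y)) ` E) dZ" by (rule hausdorff_null_mono[OF null])
    then show False using slices \<open>y \<in> Y\<close> \<open>0 < p\<close> \<open>\<not> 1 \<le> p\<close> by auto
  qed
  have "hausdorff_dim Y dY \<le> ennreal (p - 1)"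
  proof (rule ennreal_le_of_real_bounds)
    fix s :: real assume "0 < s" "ennreal (p - 1) < ennreal s"
    then have "p < 1 + s" using \<open>1 \<le> p\<close> by (simp add: ennreal_less_iff)
    then have "hausdorff_null s Y dY"
      using hausdorff_null_factor[OF Y Z f bdd slices null \<open>0 < p\<close> \<open>0 < s\<close>] by blast
    then show "hausdorff_dim Y dY \<le> ennreal s"
      using \<open>0 < s\<close> by (rule hausdorff_dim_le_of_hausdorff_null)
  qed
  then have "1 + hausdorff_dim Y dY \<le> ennreal 1 + ennreal (p - 1)"
    by (intro add_mono) auto
  also have "\<dots> = ennreal p" using \<open>1 \<le> p\<close> ennreal_plus[of 1 "p - 1"] by simp
  finally show "1 + hausdorff_dim Y dY \<le> ennreal p" .
qed

lemma hausdorff_dim_ge_1_of_measure_growth: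
  fixes lam :: "real measure"
  assumes sets: "sets lam = sets (restrict_space borel E)" and "a \<in> E"
    and bounds: "\<And>\<epsilon>::real. \<epsilon> > 0 \<Longrightarrow>
      \<exists>C::real. C > 0 \<and> (\<forall>x\<in>E. \<forall>r::real. 0 < r \<and> r \<le> 1 \<longrightarrow>
        ennreal (1 / C * r powr (1 + \<epsilon>)) \<le> emeasure lam (E \<inter> ball x r) \<and>
        emeasure lam (E \<inter> ball x r) \<le> ennreal (C * r powr (1 - \<epsilon>)))"
  shows "1 \<le> hausdorff_dim E dist"
proof (rule ennreal_le_of_real_bounds)
  fix p :: real assume "0 < p" "hausdorff_dim E dist < ennreal p"
  then have null: "hausdorff_null p E dist" by (intro hausdorff_null_of_hausdorff_dim_less)
  have "1 \<le> p"
  proof (rule ccontr)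
    assume "\<not> 1 \<le> p"
    then obtain C where "0 < C" and C: "\<And>x r. x \<in> E \<Longrightarrow> 0 < r \<Longrightarrow> r \<le> 1 \<Longrightarrow>
        ennreal (1 / C * r powr (1 + (1 - p))) \<le> emeasure lam (E \<inter> ball x r) \<and>
        emeasure lam (E \<inter> ball x r) \<le> ennreal (C * r powr (1 - (1 - p)))"
      using bounds[of "1 - p"] by auto
    have "\<not> hausdorff_null p E dist"
    proof (rule not_hausdorff_null_of_measure_growth[OF sets \<open>0 < p\<close> \<open>0 < C\<close>])
      show "emeasure lam (E \<inter> ball x r) \<le> ennreal (C * r powr p)" if "x \<in> E" "0 < r" "r \<le> 1" for x r
        using C[OF that] by simp
      show "ennreal (1 / C) \<le> emeasure lam (E \<inter> ball a 1)" using C[OF \<open>a \<in> E\<close>, of 1] by simp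
    qed (use \<open>0 < C\<close> in simp)
    with null show False by blast
  qed
  then show "1 \<le> ennreal p" by simp
qed

theorem theorem1p2:
  fixes E :: "real set" and lam :: "real measure"
    and Y :: "'b set" and dY :: "'b \<Rightarrow> 'b \<Rightarrow> real"
  assumes E_minimal: "minimal_for_conformal_dim E dist"
    and lam_borel: "sets lam = sets (restrict_space borel E)"
    and lam_bounds: "\<And>\<epsilon>::real. \<epsilon> > 0 \<Longrightarrow>
      \<exists>C::real. C > 0 \<and> (\<forall>x\<in>E. \<forall>r::real. 0 < r \<and> r \<le> 1 \<longrightarrow>
        ennreal (1 / C * r powr (1 + \<epsilon>)) \<le> emeasure lam (E \<inter> ball x r) \<and>
        emeasure lam (E \<inter> ball x r) \<le> ennreal (C * r powr (1 - \<epsilon>)))"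
    and Y_metric: "Metric_space Y dY"
    and Y_compact: "compact_space (Metric_space.mtopology Y dY)"
    and Y_nonempty: "Y \<noteq> {}"
  shows "minimal_for_conformal_dim (E \<times> Y) (max_dist dist dY)"
proof -
  interpret Y: Metric_space Y dY by fact
  have "Metric_space (E \<times> Y) (max_dist dist dY)"
    by (rule Metric_space_max_dist[OF Metric_space_dist_on Y_metric])
  then have upper: "conformal_dim (E \<times> Y) (max_dist dist dY) \<le> hausdorff_dim (E \<times> Y) (max_dist dist dY)"
    by (rule conformal_dim_le_hausdorff_dim)
  show ?thesis
  proof (cases "E = {}")
    case True
    have "hausdorff_dim (E \<times> Y) (max_dist dist dY) \<le> 0"
    proof (rule ennreal_le_of_real_bounds)
      fix p :: real assume "0 < p"
      have "hausdorff_null p (E \<times> Y) (max_dist dist dY)"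
        using True by (simp add: hausdorff_null_empty)
      then show "hausdorff_dim (E \<times> Y) (max_dist dist dY) \<le> ennreal p"
        using \<open>0 < p\<close> by (rule hausdorff_dim_le_of_hausdorff_null)
    qed
    with upper show ?thesis by (simp add: minimal_for_conformal_dim_def)
  next
    case False
    then obtain a where "a \<in> E" by blast
    then have "1 \<le> conformal_dim E dist"
      using hausdorff_dim_ge_1_of_measure_growth[OF lam_borel _ lam_bounds] E_minimal
      by (simp add: minimal_for_conformal_dim_def)
    moreover obtain B where "\<And>y z. y \<in> Y \<Longrightarrow> z \<in> Y \<Longrightarrow> dY y z \<le> B"
    proof -
      have "Y.mbounded Y"
        using Y_compact Y.compactin_imp_mbounded[of Y] by (simp add: compact_space_def)
      then show ?thesis using that unfolding Y.mbounded_alt by blast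
    qed
    ultimately have "1 + hausdorff_dim Y dY \<le> conformal_dim (E \<times> Y) (max_dist dist dY)"
      unfolding conformal_dim_def[of "E \<times> Y"]
      using Y_nonempty by (auto intro!: Inf_greatest hausdorff_dim_quasisymmetric_image_times_ge[OF Y_metric])
    then have "hausdorff_dim (E \<times> Y) (max_dist dist dY) \<le> conformal_dim (E \<times> Y) (max_dist dist dY)"
      by (rule order_trans[OF hausdorff_dim_times_le])
    with upper show ?thesis by (simp add: minimal_for_conformal_dim_def)
  qed
qed

end
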